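(* Let $s,p\in\mathbb{R}$ and $\alpha>1/2$ satisfy $\alpha+s>0$ and $\alpha+(p-1/2)>0$. Suppose that $l^\dagger=\{l_j^\dagger\}\in\mathcal{H}^s$; that the prior variances satisfy $\sigma_j^2=\Theta(j^{-2p})$ as $j\to\infty$; that the training covariance satisfies $\vartheta_j^2=\langle\varphi_j,\Lambda\varphi_j\rangle=\Theta(j^{-2\alpha})$ as $j\to\infty$; and that the training distribution $\nu$ satisfies the moment assumption (M) in the context. Let $J_N=\lfloor N^{1/(2(\alpha+p))}\rfloor$. Then the expected excess risk $\mathbb{E}^{D_N}\mathcal{E}_N$ of the posterior mean, where $\mathcal{E}_N=\mathbb{E}^{x\sim\nu}\|L^\dagger x-\bar L^{(N)}x\|^2$, satisfies $$\mathbb{E}^{D_N}\mathbb{E}^{x\sim\nu}\|L^\dagger x-\bar L^{(N)}x\|^2=O\Bigl(N^{-\frac{\alpha+p-1/2}{\alpha+p}}\Bigr)+o\Bigl(N^{-\frac{\alpha+s}{\alpha+p}}\Bigr)\quad\text{as }N\to\infty,$$ and for any positive sequence $\{\tau_n\}$ such that $\tau_n\to0$ and $n\tau_n\to\infty$ as $n\to\infty$, $$\mathbb{E}^{D_N}\mathbb{E}^{x\sim\nu}\|L^\dagger x-\bar L^{(N)}x\|^2=\Omega\Bigl(\tau_NN^{-\frac{\alpha+p-1/2}{\alpha+p}}+\sum_{j>J_N}j^{-2\alpha}|l_j^\dagger|^2\Bigr)\quad\text{as }N\to\infty.$$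
   Context: $H$ is a real, separable, infinite-dimensional Hilbert space with inner product $\langle\cdot,\cdot\rangle$ and norm $\|\cdot\|$; $\{\varphi_j\}_{j\in\mathbb{N}}$ is a fixed known orthonormal basis of $H$. For $s\in\mathbb{R}$, $\mathcal{H}^s=\{v:\mathbb{N}\to\mathbb{R}:\|v\|_{\mathcal{H}^s}^2=\sum_jj^{2s}|v_j|^2<\infty\}$. For nonnegative sequences, $a_n=O(b_n)$ means $\limsup a_n/b_n<\infty$, $a_n=\Omega(b_n)$ means $b_n=O(a_n)$, $a_n=\Theta(b_n)$ means both, $a_n=o(b_n)$ means $a_n/b_n\to0$. Truth: $L^\dagger=\sum_jl_j^\dagger\varphi_j\otimes\varphi_j$ is a fixed, possibly unbounded, self-adjoint operator on $H$ with real eigenvalues $l_j^\dagger$ and domain $\{h\in H:\sum_j|l_j^\dagger|^2\langle\varphi_j,h\rangle^2<\infty\}$. Data: $\gamma>0$ is fixed; $\nu$ is a centered Borel probability measure on $H$ with finite second moment and strictly positive-definite trace-class covariance operator $\Lambda$; $x_1,\dots,x_N$ are i.i.d. from $\nu$; $g_{jn}=\langle\varphi_j,x_n\rangle$; $y_{jn}=g_{jn}l_j^\dagger+\gamma\xi_{jn}$ for $j\in\mathbb{N}$, $1\le n\le N$, with $\xi_{jn}$ i.i.d. $\mathcal{N}(0,1)$ independent of $X=(x_1,\dots,x_N)$. $Y=\{y_{jn}\}$, $D_N=(X,Y)$, and $\mathbb{E}^{D_N}$ is expectation over the joint law of $D_N$. In the excess risk, $x\sim\nu$ is independent of $D_N$,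 so $\mathcal{E}_N=\sum_j\vartheta_j^2|l_j^\dagger-\bar l_j^{(N)}|^2$. Prior and posterior mean: the prior on the eigenvalues is $\bigotimes_j\mathcal{N}(0,\sigma_j^2)$ with $\sigma_j^2>0$ for all $j$. The posterior mean is $\bar L^{(N)}=\sum_j\bar l_j^{(N)}\varphi_j\otimes\varphi_j$ with $$\bar l_j^{(N)}=\frac{N\gamma^{-2}\sigma_j^2\,\frac1N\sum_{n}y_{jn}g_{jn}}{1+N\gamma^{-2}\sigma_j^2\,\frac1N\sum_ng_{jn}^2}.$$ Assumption (M): $x\sim\nu$ has Karhunen–Loève expansion $x=\sum_k\lambda_k\zeta_k\phi_k$, where $\{\phi_k\}$ is an orthonormal eigenbasis of $\Lambda$ with nonincreasing eigenvalues $\lambda_k^2$, and the zero mean, unit variance random variables $\{\zeta_k\}$ are independent, have finite fourth moments, and satisfy $\mathbb{E}[\zeta_k^4]=O(1)$ as $k\to\infty$. Moreover, there is a constant $C$ such that $\limsup_{N\to\infty}\mathbb{E}\bigl[(\frac1N\sum_{n=1}^Ng_{jn}^2)^{-4}\bigr]\le C\langle\varphi_j,\Lambda\varphi_j\rangle^{-4}$ for all $j\in\mathbb{N}$. *)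

theory Defs
  imports "HOL-Probability.Probability" "HOL-Library.Landau_Symbols"
begin

text \<open>
  Sequences indexed by the positive integers are functions on \<open>nat\<close> of which only the values
  on \<open>{1..}\<close> are used.  The Hilbert space is a type of class
  \<open>{real_inner, banach, second_countable_topology}\<close>; it is infinite-dimensional as soon as it
  has an orthonormal basis in the sense below.
\<close>

definition orthonormal_basis :: "(nat \<Rightarrow> 'a::real_inner) \<Rightarrow> bool" where
  "orthonormal_basis \<phi> \<longleftrightarrow>
     (\<forall>i\<ge>1. \<forall>j\<ge>1. \<phi> i \<bullet> \<phi> j = (if i = j then 1 else 0)) \<and>
     closure (span (\<phi> ` {1..})) = UNIV"

definition sobolev_seq :: "real \<Rightarrow> (nat \<Rightarrow> real) set" where
  "sobolev_seq s = {v. (\<lambda>j. real j powr (2 * s) * (v j)\<^sup>2) summable_on {1..}}"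

text \<open>The operator \<open>\<Sum>j. l j \<phi> j \<otimes> \<phi> j\<close>, in general unbounded, with its domain;
  the value of \<open>diag_op \<phi> l\<close> is meaningful only on \<open>diag_dom \<phi> l\<close>.\<close>

definition diag_dom :: "(nat \<Rightarrow> 'a::real_inner) \<Rightarrow> (nat \<Rightarrow> real) \<Rightarrow> 'a set" where
  "diag_dom \<phi> l = {h. (\<lambda>j. (l j)\<^sup>2 * (\<phi> j \<bullet> h)\<^sup>2) summable_on {1..}}"

definition diag_op :: "(nat \<Rightarrow> 'a::real_inner) \<Rightarrow> (nat \<Rightarrow> real) \<Rightarrow> 'a \<Rightarrow> 'a" where
  "diag_op \<phi> l h = (\<Sum>\<^sub>\<infinity>j\<in>{1..}. (l j * (\<phi> j \<bullet> h)) *\<^sub>R \<phi> j)"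

definition cov_op :: "'a::{real_inner, banach, second_countable_topology} measure \<Rightarrow> 'a \<Rightarrow> 'a" where
  "cov_op \<nu> h = (\<integral>x. (x \<bullet> h) *\<^sub>R x \<partial>\<nu>)"

text \<open>The summability condition is the trace class property of the (positive) covariance
  operator, expressed in the basis \<open>\<phi>\<close>.  It already follows from the finite second moment.\<close>

definition training_measure ::
  "(nat \<Rightarrow> 'a) \<Rightarrow> 'a::{real_inner, banach, second_countable_topology} measure \<Rightarrow> bool" where
  "training_measure \<phi> \<nu> \<longleftrightarrow>
     prob_space \<nu> \<and> sets \<nu> = sets borel \<and>
     integrable \<nu> (\<lambda>x. (norm x)\<^sup>2) \<and>
     (\<integral>x. x \<partial>\<nu>) = 0 \<and>
     (\<forall>h. h \<noteq> 0 \<longrightarrow> h \<bullet> cov_op \<nu> h > 0) \<and>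
     (\<lambda>j. \<phi> j \<bullet> cov_op \<nu> (\<phi> j)) summable_on {1..}"

definition sample_law :: "'a measure \<Rightarrow> nat \<Rightarrow> (nat \<Rightarrow> 'a) measure" where
  "sample_law \<nu> N = PiM {1..N} (\<lambda>_. \<nu>)"

definition noise_law :: "nat \<Rightarrow> (nat \<times> nat \<Rightarrow> real) measure" where
  "noise_law N = PiM ({1..} \<times> {1..N}) (\<lambda>_. density lborel (\<lambda>t. ennreal (std_normal_density t)))"

text \<open>A data set consists of inputs \<open>X n\<close> and of outputs \<open>Y (j, n)\<close>.  The law is the image of
  the product measure of inputs and noise, so that inputs and noise are independent.\<close>

definition data_map ::
  "(nat \<Rightarrow> 'a::real_inner) \<Rightarrow> real \<Rightarrow> (nat \<Rightarrow> real) \<Rightarrow> nat \<Rightarrow>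
   (nat \<Rightarrow> 'a) \<times> (nat \<times> nat \<Rightarrow> real) \<Rightarrow> (nat \<Rightarrow> 'a) \<times> (nat \<times> nat \<Rightarrow> real)" where
  "data_map \<phi> \<gamma> l N = (\<lambda>(X, \<Xi>).
     (X, \<lambda>i\<in>{1..} \<times> {1..N}. (\<phi> (fst i) \<bullet> X (snd i)) * l (fst i) + \<gamma> * \<Xi> i))"

definition data_law ::
  "(nat \<Rightarrow> 'a::real_inner) \<Rightarrow> 'a measure \<Rightarrow> real \<Rightarrow> (nat \<Rightarrow> real) \<Rightarrow> nat \<Rightarrow>
   ((nat \<Rightarrow> 'a) \<times> (nat \<times> nat \<Rightarrow> real)) measure" where
  "data_law \<phi> \<nu> \<gamma> l N =
     distr (sample_law \<nu> N \<Otimes>\<^sub>M noise_law N)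
           (PiM {1..N} (\<lambda>_. borel) \<Otimes>\<^sub>M PiM ({1..} \<times> {1..N}) (\<lambda>_. borel))
           (data_map \<phi> \<gamma> l N)"

lemma prob_space_data_law:
  fixes \<phi> :: "nat \<Rightarrow> 'a::{real_inner, second_countable_topology}"
  assumes "prob_space \<nu>" and [measurable_cong]: "sets \<nu> = sets borel"
  shows "prob_space (data_law \<phi> \<nu> \<gamma> l N)"
proof -
  let ?S = "density lborel (\<lambda>t. ennreal (std_normal_density t))"
  have [measurable_cong]: "sets (sample_law \<nu> N) = sets (PiM {1..N} (\<lambda>_. borel))"
    unfolding sample_law_def by (intro sets_PiM_cong) (auto simp: assms)
  have [measurable_cong]:
    "sets (noise_law N) = sets (PiM ({1..} \<times> {1..N}) (\<lambda>_. borel))"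
    unfolding noise_law_def by (intro sets_PiM_cong) auto
  interpret A: prob_space "sample_law \<nu> N"
    unfolding sample_law_def by (intro prob_space_PiM assms)
  interpret B: prob_space "noise_law N"
    unfolding noise_law_def by (intro prob_space_PiM prob_space_normal_density) simp
  interpret P: pair_prob_space "sample_law \<nu> N" "noise_law N" ..
  have "data_map \<phi> \<gamma> l N \<in> sample_law \<nu> N \<Otimes>\<^sub>M noise_law N \<rightarrow>\<^sub>M
      PiM {1..N} (\<lambda>_. borel) \<Otimes>\<^sub>M PiM ({1..} \<times> {1..N}) (\<lambda>_. borel)"
    unfolding data_map_def case_prod_beta
    by (intro measurable_Pair measurable_restrict) (measurable, auto)
  then show ?thesis
    unfolding data_law_def by (rule P.prob_space_distr)
qed

text \<open>Eigenvalues of the posterior mean for the prior \<open>\<Otimes>j. N(0, (\<sigma> j)\<^sup>2)\<close>.  The factor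
  \<open>1 / real N\<close> is kept so that the formula displays the empirical averages; \<open>N = 0\<close> is irrelevant.\<close>

definition post_mean ::
  "(nat \<Rightarrow> 'a::real_inner) \<Rightarrow> real \<Rightarrow> (nat \<Rightarrow> real) \<Rightarrow> nat \<Rightarrow>
   (nat \<Rightarrow> 'a) \<times> (nat \<times> nat \<Rightarrow> real) \<Rightarrow> nat \<Rightarrow> real" where
  "post_mean \<phi> \<gamma> \<sigma> N D j =
     (case D of (X, Y) \<Rightarrow>
        (real N / \<gamma>\<^sup>2 * (\<sigma> j)\<^sup>2 * (1 / real N * (\<Sum>n=1..N. Y (j, n) * (\<phi> j \<bullet> X n)))) /
        (1 + real N / \<gamma>\<^sup>2 * (\<sigma> j)\<^sup>2 * (1 / real N * (\<Sum>n=1..N. (\<phi> j \<bullet> X n)\<^sup>2))))"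

text \<open>The squared error is \<open>\<infinity>\<close> outside the domains of the two operators, so a finite
  risk means that almost every \<open>x\<close> lies in both domains.\<close>

definition sq_error ::
  "(nat \<Rightarrow> 'a::real_inner) \<Rightarrow> (nat \<Rightarrow> real) \<Rightarrow> (nat \<Rightarrow> real) \<Rightarrow> 'a \<Rightarrow> ennreal" where
  "sq_error \<phi> l m x =
     (if x \<in> diag_dom \<phi> l \<inter> diag_dom \<phi> m
      then ennreal ((norm (diag_op \<phi> l x - diag_op \<phi> m x))\<^sup>2) else \<infinity>)"

definition expected_excess_risk ::
  "(nat \<Rightarrow> 'a::real_inner) \<Rightarrow> 'a measure \<Rightarrow> real \<Rightarrow> (nat \<Rightarrow> real) \<Rightarrow> (nat \<Rightarrow> real) \<Rightarrow> nat \<Rightarrow> ennreal"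
where
  "expected_excess_risk \<phi> \<nu> \<gamma> l \<sigma> N =
     (\<integral>\<^sup>+D. (\<integral>\<^sup>+x. sq_error \<phi> l (post_mean \<phi> \<gamma> \<sigma> N D) x \<partial>\<nu>) \<partial>data_law \<phi> \<nu> \<gamma> l N)"

text \<open>Here \<open>(\<kappa> k)\<^sup>2\<close> are the eigenvalues of the covariance operator.  The variables \<open>\<zeta> k\<close> live on
  the space \<open>\<nu>\<close> itself: as the eigenvalues are positive, they are functions of \<open>x\<close>.\<close>

definition kl_moment_condition ::
  "'a::{real_inner, banach, second_countable_topology} measure \<Rightarrow> bool" where
  "kl_moment_condition \<nu> \<longleftrightarrow>
     (\<exists>(\<psi> :: nat \<Rightarrow> 'a) (\<kappa> :: nat \<Rightarrow> real) (\<zeta> :: nat \<Rightarrow> 'a \<Rightarrow> real).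
        orthonormal_basis \<psi> \<and>
        (\<forall>k\<ge>1. cov_op \<nu> (\<psi> k) = (\<kappa> k)\<^sup>2 *\<^sub>R \<psi> k) \<and>
        (\<forall>i\<ge>1. \<forall>k\<ge>i. (\<kappa> k)\<^sup>2 \<le> (\<kappa> i)\<^sup>2) \<and>
        (AE x in \<nu>. ((\<lambda>k. (\<kappa> k * \<zeta> k x) *\<^sub>R \<psi> k) has_sum x) {1..}) \<and>
        prob_space.indep_vars \<nu> (\<lambda>_. borel) \<zeta> {1..} \<and>
        (\<forall>k\<ge>1. integrable \<nu> (\<lambda>x. (\<zeta> k x) ^ 4) \<and>
               (\<integral>x. \<zeta> k x \<partial>\<nu>) = 0 \<and> (\<integral>x. (\<zeta> k x)\<^sup>2 \<partial>\<nu>) = 1) \<and>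
        (\<lambda>k. \<integral>x. (\<zeta> k x) ^ 4 \<partial>\<nu>) \<in> O(\<lambda>_. 1))"

text \<open>The inverse is taken in \<open>ennreal\<close>, where \<open>inverse 0 = \<infinity>\<close>; the expectation may be infinite
  for small \<open>N\<close>.\<close>

definition inverse_moment_condition ::
  "(nat \<Rightarrow> 'a) \<Rightarrow> 'a::{real_inner, banach, second_countable_topology} measure \<Rightarrow> bool" where
  "inverse_moment_condition \<phi> \<nu> \<longleftrightarrow>
     (\<exists>C>0. \<forall>j\<ge>1.
        limsup (\<lambda>N. \<integral>\<^sup>+X. (inverse (ennreal (1 / real N * (\<Sum>n=1..N. (\<phi> j \<bullet> X n)\<^sup>2)))) ^ 4
                       \<partial>sample_law \<nu> N)
          \<le> ennreal (C * inverse (\<phi> j \<bullet> cov_op \<nu> (\<phi> j)) ^ 4))"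

definition moment_assumption ::
  "(nat \<Rightarrow> 'a) \<Rightarrow> 'a::{real_inner, banach, second_countable_topology} measure \<Rightarrow> bool" where
  "moment_assumption \<phi> \<nu> \<longleftrightarrow> kl_moment_condition \<nu> \<and> inverse_moment_condition \<phi> \<nu>"

end

theory Submission
  imports Defs
begin

text \<open>
  Write \<open>\<theta> j\<close> for the variance of the coordinate \<open>\<phi> j \<bullet> x\<close> of an input \<open>x\<close> and \<open>S j\<close> for the sum of
  the squares of this coordinate over the \<open>N\<close> inputs.  Averaging over the noise and over the test
  input turns the expected excess risk into the series over \<open>j\<close> of
  \<open>\<theta> j * ((l j)\<^sup>2 * E[1 / (1 + t)\<^sup>2] + (\<sigma> j)\<^sup>2 * E[t / (1 + t)\<^sup>2])\<close> with the random signal-to-noise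
  ratio \<open>t = (\<sigma> j)\<^sup>2 / \<gamma>\<^sup>2 * S j\<close> (\<open>expected_excess_risk_eq_series\<close>).

  The ratio \<open>t\<close> may be replaced by its mean \<open>z\<close>, of order \<open>N * j powr (- 2 * q)\<close> with \<open>q = \<alpha> + p\<close>.  Each
  coordinate is a series of independent variables with bounded fourth moments, so its fourth
  moment is at most \<open>B * (\<theta> j)\<^sup>2\<close> with the same \<open>B\<close> for all \<open>j\<close> (\<open>uniform_fourth_moment\<close>).
  By Chebyshev's inequality \<open>t\<close> lies between \<open>z / 2\<close> and \<open>3 * z / 2\<close> off an exceptional event of
  probability at most \<open>4 * B / N\<close> (\<open>energy_concentration\<close>).  On the exceptional event both factors
  above are at most one, and the series of \<open>\<theta> j * (l j)\<^sup>2\<close> and of \<open>\<theta> j * (\<sigma> j)\<^sup>2\<close> converge, so it contributes only \<open>O(1 / N)\<close>.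

  What remains is a deterministic balance.  The ratio \<open>z\<close> crosses one at the level \<open>J N\<close>.  Below
  it every index contributes a variance of order at most \<open>1 / N\<close>, above it at most
  \<open>\<theta> j * (\<sigma> j)\<^sup>2\<close>, of order \<open>j powr (- 2 * q)\<close>; the two totals \<open>J N / N\<close> and the tail of the series have the same order, the
  first rate of the theorem (\<open>variance_le\<close>).  The bias is of order at most \<open>1 / N\<close> if \<open>p \<le> s\<close>; otherwise its
  terms, multiplied by \<open>N powr ((\<alpha> + s) / q)\<close>, are dominated by those of the squared Sobolev norm of
  \<open>l\<close> and tend to zero, so dominated convergence gives the little-o term (\<open>smooth_bias_smallo\<close>).
  For the lower bound, \<open>z\<close> is of order one for the indices between \<open>J N\<close> and \<open>2 * J N\<close>, which keep a
  fixed fraction of their prior variance, and \<open>z\<close> is bounded beyond \<open>J N\<close>, so that the bias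
  there is undiminished up to a constant (\<open>risk_ge\<close>).
\<close>

section \<open>Series over the positive integers and orthogonal series\<close>

lemma bij_betw_Suc_positive: "bij_betw Suc UNIV {1..}"
  by (rule bij_betwI[where g="\<lambda>n. n - 1"]) auto

lemma suminf_ennreal_Suc_eq_infsum:
  fixes t :: "nat \<Rightarrow> real"
  assumes "\<And>j. j \<ge> 1 \<Longrightarrow> t j \<ge> 0" and "t summable_on {1..}"
  shows "(\<Sum>i. ennreal (t (Suc i))) = ennreal (\<Sum>\<^sub>\<infinity>j\<in>{1..}. t j)"
proof -
  have "((\<lambda>i. t (Suc i)) has_sum (\<Sum>\<^sub>\<infinity>j\<in>{1..}. t j)) UNIV"
    using assms(2) by (subst has_sum_reindex_bij_betw[OF bij_betw_Suc_positive]) simp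
  then show ?thesis
    by (intro suminf_ennreal_eq has_sum_imp_sums) (auto simp: assms(1))
qed

lemma summable_on_if_suminf_ennreal_Suc:
  fixes t :: "nat \<Rightarrow> real"
  assumes "\<And>j. j \<ge> 1 \<Longrightarrow> t j \<ge> 0" and "(\<Sum>i. ennreal (t (Suc i))) \<noteq> \<infinity>"
  shows "t summable_on {1..}"
proof -
  have "summable (\<lambda>i. t (Suc i))"
    using assms by (intro summable_suminf_not_top) auto
  then have "(\<lambda>i. t (Suc i)) summable_on UNIV"
    by (subst summable_on_UNIV_nonneg_real_iff) (auto simp: assms(1))
  then show ?thesis
    by (subst (asm) summable_on_reindex_bij_betw[OF bij_betw_Suc_positive])
qed

lemma norm_sum_orthonormal:
  fixes \<phi> :: "nat \<Rightarrow> 'a::real_inner"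
  assumes "\<forall>i\<ge>1. \<forall>j\<ge>1. \<phi> i \<bullet> \<phi> j = (if i = j then 1 else 0)"
    and "finite F" and "F \<subseteq> {1..}"
  shows "(norm (\<Sum>j\<in>F. c j *\<^sub>R \<phi> j))\<^sup>2 = (\<Sum>j\<in>F. (c j)\<^sup>2)"
proof -
  have "(norm (\<Sum>j\<in>F. c j *\<^sub>R \<phi> j))\<^sup>2 = (\<Sum>i\<in>F. \<Sum>j\<in>F. c j * (c i * (\<phi> i \<bullet> \<phi> j)))"
    unfolding power2_norm_eq_inner inner_sum_left by (simp add: inner_sum_right)
  also have "\<dots> = (\<Sum>i\<in>F. \<Sum>j\<in>F. if j = i then (c i)\<^sup>2 else 0)"
  proof (intro sum.cong refl)
    fix i j assume "i \<in> F" "j \<in> F"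
    then have "i \<ge> 1" "j \<ge> 1" using assms(3) by auto
    then show "c j * (c i * (\<phi> i \<bullet> \<phi> j)) = (if j = i then (c i)\<^sup>2 else 0)"
      using assms(1) by (simp add: power2_eq_square)
  qed
  also have "\<dots> = (\<Sum>j\<in>F. (c j)\<^sup>2)"
    using assms(2) by simp
  finally show ?thesis .
qed

text \<open>The partial sums over finite index sets form a Cauchy net: by Pythagoras the distance of
  two of them is controlled by a tail of the series of squared coefficients.\<close>

lemma summable_on_orthonormal:
  fixes \<phi> :: "nat \<Rightarrow> 'a::{real_inner, banach}"
  assumes on: "\<forall>i\<ge>1. \<forall>j\<ge>1. \<phi> i \<bullet> \<phi> j = (if i = j then 1 else 0)"
    and c: "(\<lambda>j. (c j)\<^sup>2) summable_on {1..}"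
  shows "(\<lambda>j. c j *\<^sub>R \<phi> j) summable_on {1..}"
proof -
  let ?f = "\<lambda>j. c j *\<^sub>R \<phi> j"
  have "\<exists>P. eventually P (finite_subsets_at_top {1..}) \<and>
          (\<forall>F F'. P F \<and> P F' \<longrightarrow> dist (sum ?f F) (sum ?f F') < e)" if "e > 0" for e
  proof -
    have "(e/2)\<^sup>2 > 0" using that by simp
    then obtain F0 where F0: "finite F0" "F0 \<subseteq> {1..}"
      and tail: "dist (\<Sum>j\<in>F0. (c j)\<^sup>2) (\<Sum>\<^sub>\<infinity>j\<in>{1..}. (c j)\<^sup>2) \<le> (e/2)\<^sup>2 / 2"
      using infsum_finite_approximation[OF c, of "(e/2)\<^sup>2 / 2"] by auto
    have *: "dist (sum ?f F) (sum ?f F0) < e / 2" if F: "finite F" "F0 \<subseteq> F" "F \<subseteq> {1..}" for F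
    proof -
      have "(dist (sum ?f F) (sum ?f F0))\<^sup>2 = (norm (sum ?f (F - F0)))\<^sup>2"
        using F by (simp add: dist_norm sum_diff)
      also have "\<dots> = (\<Sum>j\<in>F - F0. (c j)\<^sup>2)"
        using F by (intro norm_sum_orthonormal[OF on]) auto
      also have "\<dots> = (\<Sum>j\<in>F. (c j)\<^sup>2) - (\<Sum>j\<in>F0. (c j)\<^sup>2)"
        using F by (simp add: sum_diff)
      also have "\<dots> \<le> (\<Sum>\<^sub>\<infinity>j\<in>{1..}. (c j)\<^sup>2) - (\<Sum>j\<in>F0. (c j)\<^sup>2)"
        using F c by (intro diff_right_mono finite_sum_le_infsum) auto
      also have "\<dots> \<le> (e/2)\<^sup>2 / 2"
        using tail unfolding dist_real_def by linarith
      also have "\<dots> < (e/2)\<^sup>2" using \<open>e > 0\<close> by simp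
      finally show ?thesis
        using \<open>e > 0\<close> by (intro power_less_imp_less_base[of _ 2 "e / 2"]) auto
    qed
    define P where "P F \<longleftrightarrow> finite F \<and> F0 \<subseteq> F \<and> F \<subseteq> {1..}" for F
    have "eventually P (finite_subsets_at_top {1..})"
      unfolding P_def eventually_finite_subsets_at_top using F0 by blast
    moreover have "dist (sum ?f F) (sum ?f F') < e" if "P F" "P F'" for F F'
      by (rule dist_triangle_half_l[OF * *]) (use that in \<open>auto simp: P_def\<close>)
    ultimately show ?thesis by blast
  qed
  then have "cauchy_filter (filtermap (sum ?f) (finite_subsets_at_top {1..}))"
    by (simp add: cauchy_filter_metric_filtermap)
  then obtain L' where "filtermap (sum ?f) (finite_subsets_at_top {1..}) \<le> nhds L'"
    using cauchy_filter_complete_converges[OF _ complete_UNIV, of "filtermap (sum ?f) (finite_subsets_at_top {1..})"]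
    by (auto simp: filtermap_bot_iff)
  then have "(?f has_sum L') {1..}"
    by (simp add: has_sum_def filterlim_def)
  then show ?thesis
    by (rule has_sum_imp_summable)
qed

lemma norm_infsum_orthonormal:
  fixes \<phi> :: "nat \<Rightarrow> 'a::{real_inner, banach}"
  assumes on: "\<forall>i\<ge>1. \<forall>j\<ge>1. \<phi> i \<bullet> \<phi> j = (if i = j then 1 else 0)"
    and c: "(\<lambda>j. (c j)\<^sup>2) summable_on {1..}"
  shows "(norm (\<Sum>\<^sub>\<infinity>j\<in>{1..}. c j *\<^sub>R \<phi> j))\<^sup>2 = (\<Sum>\<^sub>\<infinity>j\<in>{1..}. (c j)\<^sup>2)"
proof -
  let ?f = "\<lambda>j. c j *\<^sub>R \<phi> j"
  have "(sum ?f \<longlongrightarrow> infsum ?f {1..}) (finite_subsets_at_top {1..})"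
    using summable_on_orthonormal[OF on c] by (simp add: infsum_tendsto)
  then have "((\<lambda>F. (norm (sum ?f F))\<^sup>2) \<longlongrightarrow> (norm (infsum ?f {1..}))\<^sup>2) (finite_subsets_at_top {1..})"
    by (intro tendsto_intros)
  moreover have "((\<lambda>F. (norm (sum ?f F))\<^sup>2) \<longlongrightarrow> (\<Sum>\<^sub>\<infinity>j\<in>{1..}. (c j)\<^sup>2)) (finite_subsets_at_top {1..})"
  proof (rule Lim_transform_eventually)
    show "(sum (\<lambda>j. (c j)\<^sup>2) \<longlongrightarrow> (\<Sum>\<^sub>\<infinity>j\<in>{1..}. (c j)\<^sup>2)) (finite_subsets_at_top {1..})"
      using c by (simp add: infsum_tendsto)
    show "\<forall>\<^sub>F F in finite_subsets_at_top {1..}. (\<Sum>j\<in>F. (c j)\<^sup>2) = (norm (sum ?f F))\<^sup>2"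
      by (rule eventually_finite_subsets_at_top_weakI) (simp add: norm_sum_orthonormal[OF on])
  qed
  ultimately show ?thesis
    using tendsto_unique finite_subsets_at_top_neq_bot by blast
qed

lemma summable_on_square_diff:
  fixes a b :: "nat \<Rightarrow> real"
  assumes "(\<lambda>j. (a j)\<^sup>2) summable_on A" and "(\<lambda>j. (b j)\<^sup>2) summable_on A"
  shows "(\<lambda>j. (a j - b j)\<^sup>2) summable_on A"
proof (rule summable_on_comparison_test)
  show "(\<lambda>j. 2 * (a j)\<^sup>2 + 2 * (b j)\<^sup>2) summable_on A"
    using assms by (intro summable_on_add summable_on_cmult_right)
  show "(a j - b j)\<^sup>2 \<le> 2 * (a j)\<^sup>2 + 2 * (b j)\<^sup>2" for j
    using zero_le_power2[of "a j + b j"] by (simp add: power2_sum power2_diff)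
qed auto

text \<open>Only the coefficients of \<open>l\<close> and of the difference \<open>l - m\<close> have to be square summable against
  \<open>x\<close>; these are the two series whose expectations are under control, and together they place
  \<open>x\<close> in the domain of the second operator.\<close>

lemma sq_error_eq_series:
  fixes \<phi> :: "nat \<Rightarrow> 'a::{real_inner, banach}"
  assumes on: "\<forall>i\<ge>1. \<forall>j\<ge>1. \<phi> i \<bullet> \<phi> j = (if i = j then 1 else 0)"
    and l: "x \<in> diag_dom \<phi> l"
    and d: "(\<lambda>j. (l j - m j)\<^sup>2 * (\<phi> j \<bullet> x)\<^sup>2) summable_on {1..}"
  shows "sq_error \<phi> l m x = (\<Sum>i. ennreal ((l (Suc i) - m (Suc i))\<^sup>2 * (\<phi> (Suc i) \<bullet> x)\<^sup>2))"
proof -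
  let ?a = "\<lambda>j. l j * (\<phi> j \<bullet> x)" and ?b = "\<lambda>j. m j * (\<phi> j \<bullet> x)"
  have eq: "(?a j - ?b j)\<^sup>2 = (l j - m j)\<^sup>2 * (\<phi> j \<bullet> x)\<^sup>2" for j
    by (metis left_diff_distrib power_mult_distrib)
  have d': "(\<lambda>j. (?a j - ?b j)\<^sup>2) summable_on {1..}"
    using d unfolding eq .
  have a: "(\<lambda>j. (?a j)\<^sup>2) summable_on {1..}"
    using l by (simp add: diag_dom_def power_mult_distrib)
  have b: "(\<lambda>j. (?b j)\<^sup>2) summable_on {1..}"
    using summable_on_square_diff[OF a d'] by simp
  then have m: "x \<in> diag_dom \<phi> m"
    by (simp add: diag_dom_def power_mult_distrib)
  have A: "((\<lambda>j. ?a j *\<^sub>R \<phi> j) has_sum diag_op \<phi> l x) {1..}"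
    unfolding diag_op_def by (rule has_sum_infsum[OF summable_on_orthonormal[OF on a]])
  have "((\<lambda>j. ?b j *\<^sub>R \<phi> j) has_sum diag_op \<phi> m x) {1..}"
    unfolding diag_op_def by (rule has_sum_infsum[OF summable_on_orthonormal[OF on b]])
  then have B: "((\<lambda>j. - (?b j *\<^sub>R \<phi> j)) has_sum - diag_op \<phi> m x) {1..}"
    by (subst has_sum_uminus) simp
  have "diag_op \<phi> l x - diag_op \<phi> m x = (\<Sum>\<^sub>\<infinity>j\<in>{1..}. (?a j - ?b j) *\<^sub>R \<phi> j)"
    using infsumI[OF has_sum_add[OF A B]] by (simp add: scaleR_left_diff_distrib)
  then have "(norm (diag_op \<phi> l x - diag_op \<phi> m x))\<^sup>2 = (\<Sum>\<^sub>\<infinity>j\<in>{1..}. (l j - m j)\<^sup>2 * (\<phi> j \<bullet> x)\<^sup>2)"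
    using norm_infsum_orthonormal[OF on d'] by (simp only: eq)
  then show ?thesis
    using l m by (subst suminf_ennreal_Suc_eq_infsum[OF _ d]) (auto simp: sq_error_def)
qed

section \<open>Second and fourth moments of the coordinates\<close>

lemma integrable_inner_mult_inner:
  fixes \<nu> :: "'a::{real_inner, banach, second_countable_topology} measure"
  assumes [measurable_cong]: "sets \<nu> = sets borel" and int: "integrable \<nu> (\<lambda>x. (norm x)\<^sup>2)"
  shows "integrable \<nu> (\<lambda>x. (u \<bullet> x) * (v \<bullet> x))"
proof (rule Bochner_Integration.integrable_bound)
  show "integrable \<nu> (\<lambda>x. norm u * norm v * (norm x)\<^sup>2)"
    using int by simp
  show "AE x in \<nu>. norm ((u \<bullet> x) * (v \<bullet> x)) \<le> norm (norm u * norm v * (norm x)\<^sup>2)"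
  proof (rule AE_I2)
    fix x
    have "\<bar>u \<bullet> x\<bar> * \<bar>v \<bullet> x\<bar> \<le> (norm u * norm x) * (norm v * norm x)"
      by (intro mult_mono Cauchy_Schwarz_ineq2) auto
    then show "norm ((u \<bullet> x) * (v \<bullet> x)) \<le> norm (norm u * norm v * (norm x)\<^sup>2)"
      by (simp add: abs_mult power2_eq_square algebra_simps)
  qed
qed measurable

lemma inner_cov_op:
  fixes \<nu> :: "'a::{real_inner, banach, second_countable_topology} measure"
  assumes [measurable_cong]: "sets \<nu> = sets borel" and int: "integrable \<nu> (\<lambda>x. (norm x)\<^sup>2)"
  shows "u \<bullet> cov_op \<nu> v = (\<integral>x. (u \<bullet> x) * (v \<bullet> x) \<partial>\<nu>)"
proof -
  have "integrable \<nu> (\<lambda>x. (x \<bullet> v) *\<^sub>R x)"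
  proof (rule Bochner_Integration.integrable_bound)
    show "integrable \<nu> (\<lambda>x. norm v * (norm x)\<^sup>2)"
      using int by simp
    show "AE x in \<nu>. norm ((x \<bullet> v) *\<^sub>R x) \<le> norm (norm v * (norm x)\<^sup>2)"
    proof (rule AE_I2)
      fix x
      have "\<bar>x \<bullet> v\<bar> * norm x \<le> (norm x * norm v) * norm x"
        by (intro mult_right_mono Cauchy_Schwarz_ineq2) auto
      then show "norm ((x \<bullet> v) *\<^sub>R x) \<le> norm (norm v * (norm x)\<^sup>2)"
        by (simp add: power2_eq_square algebra_simps)
    qed
  qed measurable
  then have "u \<bullet> cov_op \<nu> v = (\<integral>x. u \<bullet> ((x \<bullet> v) *\<^sub>R x) \<partial>\<nu>)"
    unfolding cov_op_def by (intro integral_inner_right[symmetric])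
  then show ?thesis
    by (simp add: inner_commute mult.commute)
qed

text \<open>The covariance form is nonnegative and diagonal in an eigenbasis, so discarding all but
  finitely many eigendirections of \<open>h\<close> can only decrease its variance.\<close>

lemma eigen_energy_le_variance:
  fixes \<nu> :: "'a::{real_inner, banach, second_countable_topology} measure"
    and \<psi> :: "nat \<Rightarrow> 'a" and \<kappa> :: "nat \<Rightarrow> real"
  assumes [measurable_cong]: "sets \<nu> = sets borel" and int: "integrable \<nu> (\<lambda>x. (norm x)\<^sup>2)"
    and on: "\<forall>i\<ge>1. \<forall>j\<ge>1. \<psi> i \<bullet> \<psi> j = (if i = j then 1 else 0)"
    and eig: "\<forall>k\<ge>1. cov_op \<nu> (\<psi> k) = (\<kappa> k)\<^sup>2 *\<^sub>R \<psi> k"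
  shows "(\<Sum>k=1..n. (\<kappa> k * (\<psi> k \<bullet> h))\<^sup>2) \<le> h \<bullet> cov_op \<nu> h"
proof -
  note I = integrable_inner_mult_inner[OF assms(1) int]
  define b where "b u v = (\<integral>x. (u \<bullet> x) * (v \<bullet> x) \<partial>\<nu>)" for u v
  define c where "c k = \<psi> k \<bullet> h" for k
  define P where "P = (\<Sum>k=1..n. c k *\<^sub>R \<psi> k)"
  have b_psi: "b u (\<psi> k) = (\<kappa> k)\<^sup>2 * (u \<bullet> \<psi> k)" if "k \<ge> 1" for u k
    using that eig inner_cov_op[OF assms(1) int, of u "\<psi> k"] by (simp add: b_def)
  have b_P: "b u P = (\<Sum>k=1..n. c k * ((\<kappa> k)\<^sup>2 * (u \<bullet> \<psi> k)))" for u
  proof -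
    have "b u P = (\<integral>x. (\<Sum>k=1..n. c k * ((u \<bullet> x) * (\<psi> k \<bullet> x))) \<partial>\<nu>)"
      by (simp add: b_def P_def inner_sum_left sum_distrib_left mult.left_commute)
    also have "\<dots> = (\<Sum>k=1..n. c k * b u (\<psi> k))"
      using I by (subst Bochner_Integration.integral_sum) (auto simp: b_def)
    finally show ?thesis
      by (simp add: b_psi)
  qed
  have P_psi: "P \<bullet> \<psi> k = c k" if "k \<in> {1..n}" for k
  proof -
    have "P \<bullet> \<psi> k = (\<Sum>i=1..n. if i = k then c i else 0)"
      unfolding P_def inner_sum_left using on that by (intro sum.cong) auto
    also have "\<dots> = c k" using that by (subst sum.delta) auto
    finally show ?thesis .
  qed
  have bPP: "b P P = (\<Sum>k=1..n. (\<kappa> k * c k)\<^sup>2)"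
    unfolding b_P by (intro sum.cong) (auto simp: P_psi power2_eq_square)
  have brP: "b (h - P) P = 0"
    unfolding b_P inner_diff_left by (intro sum.neutral) (auto simp: P_psi c_def inner_commute[of h])
  have "b h h = b P P + 2 * b (h - P) P + b (h - P) (h - P)"
  proof -
    have "b P P + 2 * b (h - P) P + b (h - P) (h - P) =
       (\<integral>x. (P \<bullet> x) * (P \<bullet> x) + 2 * (((h - P) \<bullet> x) * (P \<bullet> x)) + ((h - P) \<bullet> x) * ((h - P) \<bullet> x) \<partial>\<nu>)"
      unfolding b_def using I by simp
    also have "\<dots> = b h h"
      unfolding b_def by (intro Bochner_Integration.integral_cong refl) (simp add: inner_diff_left algebra_simps)
    finally show ?thesis ..
  qed
  moreover have "b (h - P) (h - P) \<ge> 0"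
    unfolding b_def by (intro integral_nonneg_AE) auto
  ultimately show ?thesis
    using inner_cov_op[OF assms(1) int, of h h] bPP brP unfolding b_def[symmetric] c_def by simp
qed

lemma (in prob_space) integrable_lower_power:
  fixes f :: "'a \<Rightarrow> real"
  assumes [measurable]: "f \<in> borel_measurable M" and "integrable M (\<lambda>x. f x ^ 4)" and "k \<le> 4"
  shows "integrable M (\<lambda>x. f x ^ k)"
proof (rule Bochner_Integration.integrable_bound)
  show "integrable M (\<lambda>x. 1 + f x ^ 4)"
    using assms(2) by simp
  show "AE x in M. norm (f x ^ k) \<le> norm (1 + f x ^ 4)"
  proof (rule AE_I2)
    fix x
    have "\<bar>f x\<bar> ^ k \<le> 1 + \<bar>f x\<bar> ^ 4"
    proof (cases "\<bar>f x\<bar> \<le> 1")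
      case True
      then have "\<bar>f x\<bar> ^ k \<le> 1" by (intro power_le_one) auto
      then show ?thesis
        by (rule order_trans) simp
    next
      case False
      then have "\<bar>f x\<bar> ^ k \<le> \<bar>f x\<bar> ^ 4" using assms(3) by (intro power_increasing) auto
      then show ?thesis by simp
    qed
    then show "norm (f x ^ k) \<le> norm (1 + f x ^ 4)"
      by (simp add: power_abs power_even_abs)
  qed
qed measurable

text \<open>Expanding the fourth power of a sum, independence and centering leave only even terms;
  \<open>B \<ge> 3\<close> dominates the combinatorial factor of the mixed terms.\<close>

lemma (in prob_space) fourth_moment_sum_le:
  fixes \<zeta> :: "nat \<Rightarrow> 'a \<Rightarrow> real"
  assumes ind: "indep_vars (\<lambda>_. borel) \<zeta> {1..}"
    and mom: "\<And>k. k \<ge> 1 \<Longrightarrow> integrable M (\<lambda>x. \<zeta> k x ^ 4)"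
    and mean: "\<And>k. k \<ge> 1 \<Longrightarrow> expectation (\<zeta> k) = 0"
    and var: "\<And>k. k \<ge> 1 \<Longrightarrow> expectation (\<lambda>x. (\<zeta> k x)\<^sup>2) = 1"
    and B: "\<And>k. k \<ge> 1 \<Longrightarrow> expectation (\<lambda>x. \<zeta> k x ^ 4) \<le> B" "B \<ge> 3"
  shows "integrable M (\<lambda>x. (\<Sum>k=1..n. c k * \<zeta> k x) ^ 4)
    \<and> expectation (\<lambda>x. \<Sum>k=1..n. c k * \<zeta> k x) = 0
    \<and> expectation (\<lambda>x. (\<Sum>k=1..n. c k * \<zeta> k x)\<^sup>2) = (\<Sum>k=1..n. (c k)\<^sup>2)
    \<and> expectation (\<lambda>x. (\<Sum>k=1..n. c k * \<zeta> k x) ^ 4) \<le> B * (\<Sum>k=1..n. (c k)\<^sup>2)\<^sup>2"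
proof (induction n)
  case 0
  then show ?case by simp
next
  case (Suc n)
  have rv: "\<zeta> k \<in> borel_measurable M" if "k \<ge> 1" for k
    using ind that by (auto simp: indep_vars_def)
  define T where "T x = (\<Sum>k=1..n. c k * \<zeta> k x)" for x
  define Z where "Z x = c (Suc n) * \<zeta> (Suc n) x" for x
  define V where "V = (\<Sum>k=1..n. (c k)\<^sup>2)"
  have V: "V \<ge> 0" unfolding V_def by (intro sum_nonneg) auto
  have [measurable]: "T \<in> borel_measurable M"
    unfolding T_def[abs_def] by (intro borel_measurable_sum borel_measurable_times rv) auto
  have [measurable]: "Z \<in> borel_measurable M"
    using rv[of "Suc n"] unfolding Z_def[abs_def] by simp
  have T4: "integrable M (\<lambda>x. T x ^ 4)"
    using Suc.IH unfolding T_def[abs_def] by blast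
  have IT: "integrable M (\<lambda>x. T x ^ k)" if "k \<le> 4" for k
    by (rule integrable_lower_power[OF _ T4 that]) simp
  have Z4: "integrable M (\<lambda>x. Z x ^ 4)"
    using mom[of "Suc n"] by (simp add: Z_def power_mult_distrib)
  have IZ: "integrable M (\<lambda>x. Z x ^ k)" if "k \<le> 4" for k
    by (rule integrable_lower_power[OF _ Z4 that]) simp
  have "indep_vars (\<lambda>_. borel) (\<lambda>k x. c k * \<zeta> k x) {1..}"
    by (rule indep_vars_compose2[OF ind]) simp
  then have "indep_vars (\<lambda>_. borel) (\<lambda>k x. c k * \<zeta> k x) (insert (Suc n) {1..n})"
    by (rule indep_vars_subset) auto
  then have "indep_var borel (\<lambda>x. c (Suc n) * \<zeta> (Suc n) x) borel (\<lambda>x. \<Sum>k=1..n. c k * \<zeta> k x)"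
    by (intro indep_vars_sum) auto
  then have "indep_var borel Z borel T"
    by (simp add: T_def[abs_def] Z_def[abs_def])
  then have ZT: "indep_var borel ((\<lambda>z. z ^ a) \<circ> Z) borel ((\<lambda>t. t ^ b) \<circ> T)" for a b :: nat
    by (rule indep_var_compose) auto
  have ZTi: "integrable M (\<lambda>x. Z x ^ a * T x ^ b)"
    and ZTe: "expectation (\<lambda>x. Z x ^ a * T x ^ b) = expectation (\<lambda>x. Z x ^ a) * expectation (\<lambda>x. T x ^ b)"
    if "a \<le> 4" "b \<le> 4" for a b
    using indep_var_integrable[OF ZT, of a b] indep_var_lebesgue_integral[OF ZT, of a b] IT IZ that
    by (auto simp: comp_def)
  have ET: "expectation T = 0" "expectation (\<lambda>x. (T x)\<^sup>2) = V" "expectation (\<lambda>x. T x ^ 4) \<le> B * V\<^sup>2"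
    using Suc.IH unfolding T_def[abs_def] V_def by blast+
  have EZ: "expectation Z = 0" "expectation (\<lambda>x. (Z x)\<^sup>2) = (c (Suc n))\<^sup>2"
    "expectation (\<lambda>x. Z x ^ 4) \<le> B * (c (Suc n)) ^ 4"
    using mean[of "Suc n"] var[of "Suc n"] mult_right_mono[OF B(1)[of "Suc n"], of "c (Suc n) ^ 4"]
    by (auto simp: Z_def[abs_def] power_mult_distrib mult.commute)
  have S: "(\<Sum>k=1..Suc n. c k * \<zeta> k x) = Z x + T x" for x
    by (simp add: Z_def T_def)
  have p2: "(Z x + T x)\<^sup>2 = Z x ^ 2 * T x ^ 0 + 2 * (Z x ^ 1 * T x ^ 1) + Z x ^ 0 * T x ^ 2" for x
    by (simp add: power2_sum)
  have p4: "(Z x + T x) ^ 4 = Z x ^ 4 * T x ^ 0 + 4 * (Z x ^ 3 * T x ^ 1) + 6 * (Z x ^ 2 * T x ^ 2)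
      + 4 * (Z x ^ 1 * T x ^ 3) + Z x ^ 0 * T x ^ 4" for x
    by algebra
  have i4: "integrable M (\<lambda>x. (Z x + T x) ^ 4)"
    unfolding p4 using ZTi[of 4 0] ZTi[of 3 1] ZTi[of 2 2] ZTi[of 1 3] ZTi[of 0 4] by simp
  have e1: "expectation (\<lambda>x. Z x + T x) = 0"
    using IT[of 1] IZ[of 1] ET(1) EZ(1) by simp
  have e2: "expectation (\<lambda>x. (Z x + T x)\<^sup>2) = (c (Suc n))\<^sup>2 + V"
  proof -
    have "expectation (\<lambda>x. (Z x + T x)\<^sup>2) = expectation (\<lambda>x. Z x ^ 2 * T x ^ 0)
        + 2 * expectation (\<lambda>x. Z x ^ 1 * T x ^ 1) + expectation (\<lambda>x. Z x ^ 0 * T x ^ 2)"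
      unfolding p2 using ZTi[of 2 0] ZTi[of 1 1] ZTi[of 0 2] by simp
    also have "\<dots> = (c (Suc n))\<^sup>2 + V"
      using ZTe[of 1 1] ET EZ by simp
    finally show ?thesis .
  qed
  have e4: "expectation (\<lambda>x. (Z x + T x) ^ 4) \<le> B * ((c (Suc n))\<^sup>2 + V)\<^sup>2"
  proof -
    have "expectation (\<lambda>x. (Z x + T x) ^ 4) = expectation (\<lambda>x. Z x ^ 4 * T x ^ 0)
        + 4 * expectation (\<lambda>x. Z x ^ 3 * T x ^ 1) + 6 * expectation (\<lambda>x. Z x ^ 2 * T x ^ 2)
        + 4 * expectation (\<lambda>x. Z x ^ 1 * T x ^ 3) + expectation (\<lambda>x. Z x ^ 0 * T x ^ 4)"
      unfolding p4 using ZTi[of 4 0] ZTi[of 3 1] ZTi[of 2 2] ZTi[of 1 3] ZTi[of 0 4] by simp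
    also have "\<dots> = expectation (\<lambda>x. Z x ^ 4) + 6 * ((c (Suc n))\<^sup>2 * V) + expectation (\<lambda>x. T x ^ 4)"
      using ZTe[of 3 1] ZTe[of 2 2] ZTe[of 1 3] ET EZ by simp
    also have "\<dots> \<le> B * (c (Suc n)) ^ 4 + 2 * B * ((c (Suc n))\<^sup>2 * V) + B * V\<^sup>2"
      using B(2) V by (intro add_mono ET(3) EZ(3) mult_right_mono) auto
    also have "\<dots> = B * ((c (Suc n))\<^sup>2 + V)\<^sup>2"
      by algebra
    finally show ?thesis .
  qed
  have V': "(\<Sum>k=1..Suc n. (c k)\<^sup>2) = (c (Suc n))\<^sup>2 + V"
    by (simp add: V_def)
  show ?case
    unfolding S V' using i4 e1 e2 e4 by blast
qed

lemma has_sum_positive_imp_LIMSEQ: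
  assumes "(f has_sum s) {1..}"
  shows "(\<lambda>n. \<Sum>k=1..n. f k) \<longlonglongrightarrow> s"
proof -
  have "filterlim (\<lambda>n. {1..n::nat}) (finite_subsets_at_top {1..}) sequentially"
    unfolding filterlim_finite_subsets_at_top
  proof (intro allI impI)
    fix X :: "nat set" assume X: "finite X \<and> X \<subseteq> {1..}"
    show "\<forall>\<^sub>F n in sequentially. finite {1..n} \<and> X \<subseteq> {1..n} \<and> {1..n} \<subseteq> {1..}"
      using eventually_ge_at_top[of "Max (insert 0 X)"]
      by eventually_elim (use X in auto)
  qed
  then show ?thesis
    using assms unfolding has_sum_def by (rule filterlim_compose[rotated])
qed

text \<open>Every coordinate of \<open>x\<close> is a limit of sums of independent variables, so Fatou's lemma
  transfers the bound for finite sums.  The constant does not depend on the direction \<open>h\<close>; this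
  uniformity lets all coordinates concentrate at the same speed.\<close>

lemma uniform_fourth_moment:
  fixes \<nu> :: "'a::{real_inner, banach, second_countable_topology} measure"
  assumes "prob_space \<nu>" and [measurable_cong]: "sets \<nu> = sets borel"
    and int: "integrable \<nu> (\<lambda>x. (norm x)\<^sup>2)"
    and kl: "kl_moment_condition \<nu>"
  obtains B where "B > 0"
    and "\<And>h. integrable \<nu> (\<lambda>x. (h \<bullet> x) ^ 4)"
    and "\<And>h. (\<integral>x. (h \<bullet> x) ^ 4 \<partial>\<nu>) \<le> B * (h \<bullet> cov_op \<nu> h)\<^sup>2"
proof -
  interpret prob_space \<nu> by fact
  obtain \<psi> \<kappa> \<zeta> where on: "orthonormal_basis \<psi>"
    and eig: "\<forall>k\<ge>1. cov_op \<nu> (\<psi> k) = (\<kappa> k)\<^sup>2 *\<^sub>R \<psi> k"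
    and ae: "AE x in \<nu>. ((\<lambda>k. (\<kappa> k * \<zeta> k x) *\<^sub>R \<psi> k) has_sum x) {1..}"
    and ind: "indep_vars (\<lambda>_. borel) \<zeta> {1..}"
    and mom: "\<forall>k\<ge>1. integrable \<nu> (\<lambda>x. (\<zeta> k x) ^ 4) \<and>
               (\<integral>x. \<zeta> k x \<partial>\<nu>) = 0 \<and> (\<integral>x. (\<zeta> k x)\<^sup>2 \<partial>\<nu>) = 1"
    and O: "(\<lambda>k. \<integral>x. (\<zeta> k x) ^ 4 \<partial>\<nu>) \<in> O(\<lambda>_. 1)"
    using kl unfolding kl_moment_condition_def by blast
  have on': "\<forall>i\<ge>1. \<forall>j\<ge>1. \<psi> i \<bullet> \<psi> j = (if i = j then 1 else 0)"
    using on by (simp add: orthonormal_basis_def)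
  have "Bseq (\<lambda>k. \<integral>x. (\<zeta> k x) ^ 4 \<partial>\<nu>)"
  proof -
    obtain c where "\<forall>\<^sub>F k in sequentially. norm (\<integral>x. (\<zeta> k x) ^ 4 \<partial>\<nu>) \<le> c * norm (1::real)"
      using O by (auto elim!: landau_o.bigE)
    then show ?thesis by (auto intro!: BfunI)
  qed
  then obtain K where K: "\<And>k. norm (\<integral>x. (\<zeta> k x) ^ 4 \<partial>\<nu>) \<le> K"
    unfolding Bseq_def by blast
  define B where "B = max K 3"
  have B: "B \<ge> 3" and BK: "\<And>k. (\<integral>x. (\<zeta> k x) ^ 4 \<partial>\<nu>) \<le> B"
    using K by (auto simp: B_def) (meson abs_le_D1 le_max_iff_disj)
  have rv: "\<zeta> k \<in> borel_measurable \<nu>" if "k \<ge> 1" for k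
    using ind that by (auto simp: indep_vars_def)
  have main: "integrable \<nu> (\<lambda>x. (h \<bullet> x) ^ 4) \<and> (\<integral>x. (h \<bullet> x) ^ 4 \<partial>\<nu>) \<le> B * (h \<bullet> cov_op \<nu> h)\<^sup>2" for h
  proof -
    define c where "c k = \<kappa> k * (\<psi> k \<bullet> h)" for k
    define T where "T n x = (\<Sum>k=1..n. c k * \<zeta> k x)" for n x
    have [measurable]: "T n \<in> borel_measurable \<nu>" for n
      unfolding T_def[abs_def] by (intro borel_measurable_sum borel_measurable_times rv) auto
    have T: "integrable \<nu> (\<lambda>x. T n x ^ 4)" "(\<integral>x. T n x ^ 4 \<partial>\<nu>) \<le> B * (\<Sum>k=1..n. (c k)\<^sup>2)\<^sup>2" for n
      using fourth_moment_sum_le[OF ind, of B c n] mom BK B by (auto simp: T_def)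
    have V: "(\<Sum>k=1..n. (c k)\<^sup>2) \<le> h \<bullet> cov_op \<nu> h" for n
      unfolding c_def by (rule eigen_energy_le_variance[OF assms(2) int on' eig])
    let ?R = "B * (h \<bullet> cov_op \<nu> h)\<^sup>2"
    have R: "?R \<ge> 0" using B by simp
    have TR: "(\<integral>x. T n x ^ 4 \<partial>\<nu>) \<le> ?R" for n
      using B by (intro order_trans[OF T(2)] mult_left_mono power_mono V sum_nonneg) auto
    have lim: "AE x in \<nu>. (\<lambda>n. T n x) \<longlonglongrightarrow> h \<bullet> x"
      using ae
    proof eventually_elim
      case (elim x)
      have "((\<lambda>k. h \<bullet> ((\<kappa> k * \<zeta> k x) *\<^sub>R \<psi> k)) has_sum (h \<bullet> x)) {1..}"
        by (rule has_sum_bounded_linear[OF bounded_linear_inner_right elim])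
      from has_sum_positive_imp_LIMSEQ[OF this] show ?case
        by (simp add: T_def c_def inner_commute mult_ac)
    qed
    have "(\<integral>\<^sup>+x. ennreal ((h \<bullet> x) ^ 4) \<partial>\<nu>) = (\<integral>\<^sup>+x. liminf (\<lambda>n. ennreal (T n x ^ 4)) \<partial>\<nu>)"
      using lim
    proof (intro nn_integral_cong_AE, eventually_elim)
      case (elim x)
      then have "(\<lambda>n. ennreal (T n x ^ 4)) \<longlonglongrightarrow> ennreal ((h \<bullet> x) ^ 4)"
        by (intro tendsto_intros)
      then show ?case
        by (intro lim_imp_Liminf[symmetric]) auto
    qed
    also have "\<dots> \<le> liminf (\<lambda>n. \<integral>\<^sup>+x. ennreal (T n x ^ 4) \<partial>\<nu>)"
      by (rule nn_integral_liminf) simp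
    also have "\<dots> \<le> ennreal ?R"
    proof (rule Liminf_le)
      show "\<forall>\<^sub>F n in sequentially. (\<integral>\<^sup>+x. ennreal (T n x ^ 4) \<partial>\<nu>) \<le> ennreal ?R"
        using T(1) TR by (auto simp: nn_integral_eq_integral ennreal_leI)
    qed simp
    finally have le: "(\<integral>\<^sup>+x. ennreal ((h \<bullet> x) ^ 4) \<partial>\<nu>) \<le> ennreal ?R" .
    then have i: "integrable \<nu> (\<lambda>x. (h \<bullet> x) ^ 4)"
      by (intro integrableI_bounded) (auto simp: less_top[symmetric] top_unique intro: le_less_trans)
    then show ?thesis
      using le R by (simp add: nn_integral_eq_integral)
  qed
  show thesis
    using main B by (intro that[of B]) auto
qed

section \<open>Independent coordinates and concentration of the empirical variances\<close>

lemma indep_vars_PiM_coordinates: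
  assumes "\<And>i. i \<in> I \<Longrightarrow> prob_space (M i)" and "I \<noteq> {}"
  shows "prob_space.indep_vars (PiM I M) M (\<lambda>i \<omega>. \<omega> i) I"
proof -
  interpret prob_space "PiM I M"
    by (intro prob_space_PiM assms)
  have "distr (PiM I M) (PiM I M) (\<lambda>x. \<lambda>i\<in>I. x i) = distr (PiM I M) (PiM I M) (\<lambda>x. x)"
    by (intro distr_cong) (auto simp: space_PiM PiE_restrict)
  also have "\<dots> = PiM I M"
    by (rule distr_id)
  also have "\<dots> = PiM I (\<lambda>i. distr (PiM I M) (M i) (\<lambda>\<omega>. \<omega> i))"
    using assms by (intro PiM_cong distr_PiM_component[symmetric]) auto
  finally show ?thesis
    using assms(2) by (subst indep_vars_iff_distr_eq_PiM') auto
qed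

lemma
  fixes f :: "'b \<Rightarrow> real"
  assumes "\<And>i. i \<in> I \<Longrightarrow> prob_space (M i)" and "i \<in> I" and f: "integrable (M i) f"
  shows integrable_PiM_coordinate: "integrable (PiM I M) (\<lambda>\<omega>. f (\<omega> i))"
    and integral_PiM_coordinate: "(\<integral>\<omega>. f (\<omega> i) \<partial>PiM I M) = integral\<^sup>L (M i) f"
proof -
  note D = distr_PiM_component[of I M i, OF assms(1,2)]
  have m: "(\<lambda>\<omega>. \<omega> i) \<in> measurable (PiM I M) (M i)"
    using assms(2) by simp
  have "integrable (distr (PiM I M) (M i) (\<lambda>\<omega>. \<omega> i)) f"
    using f by (simp add: D)
  then show "integrable (PiM I M) (\<lambda>\<omega>. f (\<omega> i))"
    by (rule integrable_distr[OF m])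
  have "integral\<^sup>L (distr (PiM I M) (M i) (\<lambda>\<omega>. \<omega> i)) f = (\<integral>\<omega>. f (\<omega> i) \<partial>PiM I M)"
    using f by (intro integral_distr m) auto
  then show "(\<integral>\<omega>. f (\<omega> i) \<partial>PiM I M) = integral\<^sup>L (M i) f"
    by (simp add: D)
qed

lemma
  fixes f g :: "'b \<Rightarrow> real"
  assumes M: "\<And>i. i \<in> I \<Longrightarrow> prob_space (M i)" and ij: "i \<in> I" "j \<in> I" "i \<noteq> j"
    and f: "integrable (M i) f" and g: "integrable (M j) g"
  shows integrable_PiM_coordinates_mult: "integrable (PiM I M) (\<lambda>\<omega>. f (\<omega> i) * g (\<omega> j))"
    and integral_PiM_coordinates_mult:
      "(\<integral>\<omega>. f (\<omega> i) * g (\<omega> j) \<partial>PiM I M) = integral\<^sup>L (M i) f * integral\<^sup>L (M j) g"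
proof -
  interpret prob_space "PiM I M"
    by (intro prob_space_PiM M)
  define h where "h k = (if k = i then f else g)" for k
  have "indep_vars M (\<lambda>i \<omega>. \<omega> i) I"
    using ij by (intro indep_vars_PiM_coordinates M) auto
  then have "indep_vars M (\<lambda>i \<omega>. \<omega> i) {i, j}"
    by (rule indep_vars_subset) (use ij in auto)
  then have ind: "indep_vars (\<lambda>_. borel) (\<lambda>k \<omega>. h k (\<omega> k)) {i, j}"
    by (rule indep_vars_compose2) (use f g in \<open>auto simp: h_def\<close>)
  have int: "integrable (PiM I M) (\<lambda>\<omega>. h k (\<omega> k))" if "k \<in> {i, j}" for k
    using that ij f g M by (intro integrable_PiM_coordinate) (auto simp: h_def)
  have "integrable (PiM I M) (\<lambda>\<omega>. \<Prod>k\<in>{i, j}. h k (\<omega> k))"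
    by (intro indep_vars_integrable ind int) auto
  then show "integrable (PiM I M) (\<lambda>\<omega>. f (\<omega> i) * g (\<omega> j))"
    using ij by (simp add: h_def)
  have "(\<integral>\<omega>. (\<Prod>k\<in>{i, j}. h k (\<omega> k)) \<partial>PiM I M) = (\<Prod>k\<in>{i, j}. \<integral>\<omega>. h k (\<omega> k) \<partial>PiM I M)"
    by (intro indep_vars_lebesgue_integral ind int) auto
  then show "(\<integral>\<omega>. f (\<omega> i) * g (\<omega> j) \<partial>PiM I M) = integral\<^sup>L (M i) f * integral\<^sup>L (M j) g"
    using ij f g M by (simp add: h_def integral_PiM_coordinate)
qed

lemma
  fixes f :: "'i \<Rightarrow> 'a \<Rightarrow> real"
  assumes "finite F"
    and int: "\<And>i j. i \<in> F \<Longrightarrow> j \<in> F \<Longrightarrow> integrable M (\<lambda>x. f i x * f j x)"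
    and unc: "\<And>i j. i \<in> F \<Longrightarrow> j \<in> F \<Longrightarrow> i \<noteq> j \<Longrightarrow> (\<integral>x. f i x * f j x \<partial>M) = 0"
  shows integrable_square_uncorrelated_sum: "integrable M (\<lambda>x. (\<Sum>i\<in>F. c i * f i x)\<^sup>2)"
    and integral_square_uncorrelated_sum:
      "(\<integral>x. (\<Sum>i\<in>F. c i * f i x)\<^sup>2 \<partial>M) = (\<Sum>i\<in>F. (c i)\<^sup>2 * (\<integral>x. (f i x)\<^sup>2 \<partial>M))"
proof -
  have sq: "(\<Sum>i\<in>F. c i * f i x)\<^sup>2 = (\<Sum>i\<in>F. \<Sum>j\<in>F. (c i * c j) * (f i x * f j x))" for x
    unfolding power2_eq_square sum_product by (intro sum.cong refl) (simp add: mult_ac)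
  show "integrable M (\<lambda>x. (\<Sum>i\<in>F. c i * f i x)\<^sup>2)"
    unfolding sq by (intro Bochner_Integration.integrable_sum integrable_mult_right int)
  have "(\<integral>x. (\<Sum>i\<in>F. c i * f i x)\<^sup>2 \<partial>M) = (\<Sum>i\<in>F. \<Sum>j\<in>F. (c i * c j) * (\<integral>x. f i x * f j x \<partial>M))"
    unfolding sq using int
    by (subst Bochner_Integration.integral_sum)
       (auto intro!: Bochner_Integration.integrable_sum sum.cong simp: Bochner_Integration.integral_sum)
  also have "\<dots> = (\<Sum>i\<in>F. \<Sum>j\<in>F. if j = i then (c i)\<^sup>2 * (\<integral>x. (f i x)\<^sup>2 \<partial>M) else 0)"
    by (intro sum.cong refl) (auto simp: unc power2_eq_square)
  also have "\<dots> = (\<Sum>i\<in>F. (c i)\<^sup>2 * (\<integral>x. (f i x)\<^sup>2 \<partial>M))"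
    using \<open>finite F\<close> by simp
  finally show "(\<integral>x. (\<Sum>i\<in>F. c i * f i x)\<^sup>2 \<partial>M) = (\<Sum>i\<in>F. (c i)\<^sup>2 * (\<integral>x. (f i x)\<^sup>2 \<partial>M))" .
qed

definition energy :: "'a::real_inner \<Rightarrow> nat \<Rightarrow> (nat \<Rightarrow> 'a) \<Rightarrow> real" where
  "energy h N X = (\<Sum>n=1..N. (h \<bullet> X n)\<^sup>2)"

lemma energy_nonneg: "energy h N X \<ge> 0"
  unfolding energy_def by (intro sum_nonneg) auto

lemma borel_measurable_energy [measurable]:
  fixes \<nu> :: "'a::{real_inner, second_countable_topology} measure"
  assumes [measurable_cong]: "sets \<nu> = sets borel"
  shows "energy h N \<in> borel_measurable (sample_law \<nu> N)"
  unfolding energy_def[abs_def] sample_law_def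
proof (intro borel_measurable_sum borel_measurable_power)
  fix n assume "n \<in> {1..N}"
  then have "(\<lambda>X. X n) \<in> measurable (PiM {1..N} (\<lambda>_. \<nu>)) \<nu>" by simp
  moreover have "(\<lambda>x. h \<bullet> x) \<in> borel_measurable \<nu>" by measurable
  ultimately show "(\<lambda>X. h \<bullet> X n) \<in> borel_measurable (PiM {1..N} (\<lambda>_. \<nu>))"
    by (rule measurable_compose)
qed

text \<open>Chebyshev's inequality for \<open>\<Sum>n. (h \<bullet> X n)\<^sup>2\<close>: the relative variance of one summand is at
  most \<open>B\<close>, whatever \<open>h\<close> is.\<close>

lemma energy_concentration:
  fixes \<nu> :: "'a::{real_inner, banach, second_countable_topology} measure"
  assumes "prob_space \<nu>" and bor [measurable_cong]: "sets \<nu> = sets borel"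
    and int: "integrable \<nu> (\<lambda>x. (norm x)\<^sup>2)"
    and int4: "integrable \<nu> (\<lambda>x. (h \<bullet> x) ^ 4)"
    and B: "(\<integral>x. (h \<bullet> x) ^ 4 \<partial>\<nu>) \<le> B * v\<^sup>2"
    and v: "v = h \<bullet> cov_op \<nu> h" "v > 0" and N: "N \<ge> 1"
  shows "measure (sample_law \<nu> N)
      {X \<in> space (sample_law \<nu> N). \<bar>energy h N X - real N * v\<bar> \<ge> real N * v / 2} \<le> 4 * B / real N"
proof -
  interpret nu: prob_space \<nu> by fact
  define \<mu> where "\<mu> = sample_law \<nu> N"
  interpret mu: prob_space \<mu>
    unfolding \<mu>_def sample_law_def by (intro prob_space_PiM assms)
  define u where "u x = (h \<bullet> x)\<^sup>2 - v" for x
  have iu: "integrable \<nu> (\<lambda>x. (h \<bullet> x)\<^sup>2)"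
    using integrable_inner_mult_inner[OF bor int, of h h] by (simp add: power2_eq_square)
  have i1: "integrable \<nu> u"
    using iu by (simp add: u_def[abs_def])
  have E1: "integral\<^sup>L \<nu> u = 0"
    using iu inner_cov_op[OF bor int, of h h] v
    by (simp add: u_def[abs_def] power2_eq_square nu.prob_space)
  have uu: "u x * u x = (h \<bullet> x) ^ 4 - 2 * v * (h \<bullet> x)\<^sup>2 + v\<^sup>2" for x
    unfolding u_def by algebra
  have i2: "integrable \<nu> (\<lambda>x. u x * u x)"
    unfolding uu using iu int4 by simp
  have E2: "(\<integral>x. u x * u x \<partial>\<nu>) \<le> B * v\<^sup>2"
  proof -
    have "(\<integral>x. u x * u x \<partial>\<nu>) = (\<integral>x. (h \<bullet> x) ^ 4 \<partial>\<nu>) - 2 * v * (\<integral>x. (h \<bullet> x)\<^sup>2 \<partial>\<nu>) + v\<^sup>2"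
      unfolding uu using iu int4 by (simp add: nu.prob_space)
    also have "(\<integral>x. (h \<bullet> x)\<^sup>2 \<partial>\<nu>) = v"
      using inner_cov_op[OF bor int, of h h] v by (simp add: power2_eq_square)
    finally show ?thesis
      using B v(2) by (simp add: power2_eq_square) (smt (verit) mult_nonneg_nonneg)
  qed
  have intp: "integrable \<mu> (\<lambda>X. u (X i) * u (X j))" if "i \<in> {1..N}" "j \<in> {1..N}" for i j
  proof (cases "i = j")
    case True
    have "integrable \<mu> (\<lambda>X. u (X i) * u (X i))"
      unfolding \<mu>_def sample_law_def
      using that i2 assms(1) by (intro integrable_PiM_coordinate[where f="\<lambda>x. u x * u x"]) auto
    then show ?thesis
      by (simp add: True)
  next
    case False
    then show ?thesis
      unfolding \<mu>_def sample_law_def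
      using that i1 assms(1) by (intro integrable_PiM_coordinates_mult) auto
  qed
  have unc: "(\<integral>X. u (X i) * u (X j) \<partial>\<mu>) = 0" if "i \<in> {1..N}" "j \<in> {1..N}" "i \<noteq> j" for i j
    unfolding \<mu>_def sample_law_def
    using that i1 E1 assms(1) by (subst integral_PiM_coordinates_mult) auto
  have Ssum: "(energy h N X - real N * v)\<^sup>2 = (\<Sum>n\<in>{1..N}. 1 * u (X n))\<^sup>2" for X
    by (simp add: energy_def u_def sum_subtractf)
  have Sint: "integrable \<mu> (\<lambda>X. (energy h N X - real N * v)\<^sup>2)"
    unfolding Ssum by (intro integrable_square_uncorrelated_sum intp unc) auto
  have "(\<integral>X. (energy h N X - real N * v)\<^sup>2 \<partial>\<mu>) = (\<Sum>n\<in>{1..N}. 1\<^sup>2 * (\<integral>X. (u (X n))\<^sup>2 \<partial>\<mu>))"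
    unfolding Ssum by (intro integral_square_uncorrelated_sum intp unc) auto
  also have "\<dots> = (\<Sum>n\<in>{1..N}. (\<integral>x. u x * u x \<partial>\<nu>))"
  proof (intro sum.cong refl)
    fix n assume "n \<in> {1..N}"
    then show "1\<^sup>2 * (\<integral>X. (u (X n))\<^sup>2 \<partial>\<mu>) = (\<integral>x. u x * u x \<partial>\<nu>)"
      unfolding \<mu>_def sample_law_def
      using integral_PiM_coordinate[of "{1..N}" "\<lambda>_. \<nu>" n "\<lambda>x. u x * u x"] i2 assms(1)
      by (simp add: power2_eq_square)
  qed
  also have "\<dots> \<le> real N * (B * v\<^sup>2)"
    using E2 by (simp add: mult_left_mono)
  finally have Evar: "(\<integral>X. (energy h N X - real N * v)\<^sup>2 \<partial>\<mu>) \<le> real N * (B * v\<^sup>2)" .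
  have t: "real N * v / 2 > 0" using v N by simp
  have eq: "{X \<in> space \<mu>. \<bar>energy h N X - real N * v\<bar> \<ge> real N * v / 2} =
      {X \<in> space \<mu>. (energy h N X - real N * v)\<^sup>2 \<ge> (real N * v / 2)\<^sup>2}"
    using t abs_le_square_iff[of "real N * v / 2"] by auto
  have "measure \<mu> {X \<in> space \<mu>. (energy h N X - real N * v)\<^sup>2 \<ge> (real N * v / 2)\<^sup>2}
      \<le> (\<integral>X. (energy h N X - real N * v)\<^sup>2 \<partial>\<mu>) / (real N * v / 2)\<^sup>2"
    using v N by (intro integral_Markov_inequality_measure[OF Sint, of "{}"]) auto
  also have "\<dots> \<le> real N * (B * v\<^sup>2) / (real N * v / 2)\<^sup>2"
    by (intro divide_right_mono Evar) auto
  also have "\<dots> = 4 * B / real N"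
    using v N by (simp add: field_simps power2_eq_square)
  finally show ?thesis
    unfolding eq[symmetric] unfolding \<mu>_def .
qed

text \<open>A quantity in \<open>[0, 1]\<close> that is bounded off an exceptional event is bounded in mean up to the
  probability of that event; this is how typical signal-to-noise ratios replace random ones.\<close>

lemma (in prob_space) expectation_le_except:
  fixes f :: "'a \<Rightarrow> real"
  assumes [measurable]: "f \<in> borel_measurable M" and A [measurable]: "A \<in> sets M"
    and "\<And>x. 0 \<le> f x" "\<And>x. f x \<le> 1" and c: "c \<ge> 0" "\<And>x. x \<in> space M - A \<Longrightarrow> f x \<le> c"
  shows "expectation f \<le> c + prob A"
proof -
  have ind: "integrable M (indicator A :: 'a \<Rightarrow> real)"
    by (intro integrable_const_bound[where B=1]) (auto simp: indicator_def)
  have "expectation f \<le> expectation (\<lambda>x. c + indicator A x)"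
  proof (rule integral_mono_AE)
    show "integrable M f"
      using assms by (intro integrable_const_bound[where B=1]) auto
    show "integrable M (\<lambda>x. c + indicator A x)"
      using ind by simp
    show "AE x in M. f x \<le> c + indicator A x"
      by (rule AE_I2) (use assms in \<open>auto simp: indicator_def intro: add_increasing\<close>)
  qed
  also have "\<dots> = c + prob A"
    using ind by (simp add: prob_space)
  finally show ?thesis .
qed

lemma (in prob_space) expectation_ge_except:
  fixes f :: "'a \<Rightarrow> real"
  assumes [measurable]: "f \<in> borel_measurable M" and A [measurable]: "A \<in> sets M"
    and "\<And>x. 0 \<le> f x" "\<And>x. f x \<le> 1" and c: "c \<ge> 0" "\<And>x. x \<in> space M - A \<Longrightarrow> c \<le> f x"
  shows "c * (1 - prob A) \<le> expectation f"
proof -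
  have "integrable M (indicator A :: 'a \<Rightarrow> real)"
    by (intro integrable_const_bound[where B=1]) (auto simp: indicator_def)
  then have "c * (1 - prob A) = expectation (\<lambda>x. c * (1 - indicator A x))"
    by (simp add: prob_space)
  also have "\<dots> \<le> expectation f"
  proof (rule integral_mono_AE)
    show "integrable M f"
      using assms by (intro integrable_const_bound[where B=1]) auto
    show "integrable M (\<lambda>x. c * (1 - indicator A x))"
      using c(1) by (intro integrable_const_bound[where B=c]) (auto simp: indicator_def)
    show "AE x in M. c * (1 - indicator A x) \<le> f x"
      by (rule AE_I2) (use assms in \<open>auto simp: indicator_def\<close>)
  qed
  finally show ?thesis .
qed

text \<open>\<open>shrinkage\<close> and \<open>noise_gain\<close> are the factors with which the squared truth and the prior
  variance of one eigenvalue enter its expected squared error.\<close>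

definition shrinkage :: "'a::real_inner measure \<Rightarrow> 'a \<Rightarrow> real \<Rightarrow> nat \<Rightarrow> real" where
  "shrinkage \<nu> h a N = (\<integral>X. 1 / (1 + a * energy h N X)\<^sup>2 \<partial>sample_law \<nu> N)"

definition noise_gain :: "'a::real_inner measure \<Rightarrow> 'a \<Rightarrow> real \<Rightarrow> nat \<Rightarrow> real" where
  "noise_gain \<nu> h a N = (\<integral>X. a * energy h N X / (1 + a * energy h N X)\<^sup>2 \<partial>sample_law \<nu> N)"

lemma inverse_square_bounds:
  fixes t :: real
  assumes "t \<ge> 0"
  shows "0 \<le> 1 / (1 + t)\<^sup>2" "1 / (1 + t)\<^sup>2 \<le> 1" "0 \<le> t / (1 + t)\<^sup>2" "t / (1 + t)\<^sup>2 \<le> 1"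
    "1 / (1 + t)\<^sup>2 \<le> 1 / (1 + t)" "t > 0 \<Longrightarrow> t / (1 + t)\<^sup>2 \<le> 1 / t"
proof -
  have p: "(1 + t)\<^sup>2 = 1 + 2 * t + t * t" "t * t \<ge> 0"
    by (auto simp: power2_eq_square algebra_simps)
  then have le: "1 + t \<le> (1 + t)\<^sup>2" "t * t \<le> (1 + t)\<^sup>2"
    using assms by linarith+
  have pos: "(1 + t)\<^sup>2 > 0" using assms by (intro zero_less_power) auto
  show "0 \<le> 1 / (1 + t)\<^sup>2" "0 \<le> t / (1 + t)\<^sup>2"
    using assms by auto
  show "1 / (1 + t)\<^sup>2 \<le> 1" "t / (1 + t)\<^sup>2 \<le> 1"
    unfolding pos_divide_le_eq[OF pos] mult_1 using p assms by linarith+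
  show "1 / (1 + t)\<^sup>2 \<le> 1 / (1 + t)"
    using pos le assms by (intro divide_left_mono mult_pos_pos) simp_all
  show "t / (1 + t)\<^sup>2 \<le> 1 / t" if "t > 0"
    using pos le that by (simp add: pos_divide_le_eq pos_le_divide_eq)
qed

text \<open>Off the exceptional event the random ratio \<open>t = a * energy h N X\<close> lies between one half and
  three halves of its mean \<open>a * real N * v\<close>.  For the lower bounds \<open>real N \<ge> 8 * B\<close> makes the
  exceptional probability at most one half.\<close>

context
  fixes \<nu> :: "'a::{real_inner, banach, second_countable_topology} measure"
    and h :: 'a and a v B :: real and N :: nat
  assumes nu: "prob_space \<nu>" and bor [measurable_cong]: "sets \<nu> = sets borel"
    and int: "integrable \<nu> (\<lambda>x. (norm x)\<^sup>2)"
    and int4: "integrable \<nu> (\<lambda>x. (h \<bullet> x) ^ 4)"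
    and B: "(\<integral>x. (h \<bullet> x) ^ 4 \<partial>\<nu>) \<le> B * v\<^sup>2"
    and v: "v = h \<bullet> cov_op \<nu> h" "v > 0" and N: "N \<ge> 1" and a: "a > 0"
begin

lemma
  shows shrinkage_nonneg: "0 \<le> shrinkage \<nu> h a N" and shrinkage_le_1: "shrinkage \<nu> h a N \<le> 1"
    and shrinkage_le: "shrinkage \<nu> h a N \<le> 1 / (1 + a * real N * v / 2) + 4 * B / real N"
    and shrinkage_ge: "real N \<ge> 8 * B \<Longrightarrow> shrinkage \<nu> h a N \<ge> 1 / 2 * (1 / (1 + 3 * (a * real N * v) / 2)\<^sup>2)"
    and noise_gain_nonneg: "0 \<le> noise_gain \<nu> h a N" and noise_gain_le_1: "noise_gain \<nu> h a N \<le> 1"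
    and noise_gain_le: "noise_gain \<nu> h a N \<le> 2 / (a * real N * v) + 4 * B / real N"
    and noise_gain_ge: "real N \<ge> 8 * B \<Longrightarrow>
      noise_gain \<nu> h a N \<ge> 1 / 2 * (a * real N * v / 2 / (1 + 3 * (a * real N * v) / 2)\<^sup>2)"
proof -
  define \<mu> where "\<mu> = sample_law \<nu> N"
  interpret mu: prob_space \<mu>
    unfolding \<mu>_def sample_law_def by (intro prob_space_PiM nu)
  define t where "t X = a * energy h N X" for X
  have t0: "t X \<ge> 0" for X
    using a energy_nonneg[of h N X] by (simp add: t_def)
  note tb = inverse_square_bounds[OF t0]
  have tm [measurable]: "t \<in> borel_measurable \<mu>"
    using bor unfolding t_def[abs_def] \<mu>_def by measurable
  define A where "A = {X \<in> space \<mu>. \<bar>energy h N X - real N * v\<bar> \<ge> real N * v / 2}"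
  have [measurable]: "energy h N \<in> borel_measurable \<mu>"
    unfolding \<mu>_def by (rule borel_measurable_energy[OF bor])
  have Am [measurable]: "A \<in> sets \<mu>"
    unfolding A_def by measurable
  have PA: "mu.prob A \<le> 4 * B / real N"
    using energy_concentration[OF nu bor int int4 B v N] by (simp add: A_def \<mu>_def)
  define w where "w = a * real N * v"
  have w: "w > 0" using a v N by (simp add: w_def)
  have good: "w / 2 \<le> t X" "t X \<le> 3 * w / 2" if "X \<in> space \<mu> - A" for X
  proof -
    have "\<bar>energy h N X - real N * v\<bar> < real N * v / 2"
      using that by (auto simp: A_def not_le)
    then have "real N * v / 2 \<le> energy h N X" "energy h N X \<le> 3 * (real N * v) / 2"
      unfolding abs_less_iff by linarith+
    then have "a * (real N * v / 2) \<le> t X" "t X \<le> a * (3 * (real N * v) / 2)"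
      unfolding t_def using a by (intro mult_left_mono; simp)+
    then show "w / 2 \<le> t X" "t X \<le> 3 * w / 2"
      by (simp_all add: w_def)
  qed
  have S: "shrinkage \<nu> h a N = mu.expectation (\<lambda>X. 1 / (1 + t X)\<^sup>2)"
    and G: "noise_gain \<nu> h a N = mu.expectation (\<lambda>X. t X / (1 + t X)\<^sup>2)"
    by (simp_all add: shrinkage_def noise_gain_def t_def \<mu>_def)
  show "0 \<le> shrinkage \<nu> h a N" "0 \<le> noise_gain \<nu> h a N"
    unfolding S G by (intro Bochner_Integration.integral_nonneg tb)+
  show "shrinkage \<nu> h a N \<le> 1"
    unfolding S by (rule mu.integral_le_const) (auto intro!: mu.integrable_const_bound[where B=1] tb)
  have "norm (t X / (1 + t X)\<^sup>2) \<le> 1" for X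
    unfolding real_norm_def abs_of_nonneg[OF tb(3)] by (rule tb)
  then have "integrable \<mu> (\<lambda>X. t X / (1 + t X)\<^sup>2)"
    by (intro mu.integrable_const_bound[where B=1] AE_I2) measurable
  then show "noise_gain \<nu> h a N \<le> 1"
    unfolding G by (rule mu.integral_le_const) (intro AE_I2 tb)
  have "shrinkage \<nu> h a N \<le> 1 / (1 + w / 2) + mu.prob A"
    unfolding S
  proof (rule mu.expectation_le_except[OF _ Am])
    fix X assume X: "X \<in> space \<mu> - A"
    have "1 / (1 + t X)\<^sup>2 \<le> 1 / (1 + t X)" by (rule tb)
    also have "\<dots> \<le> 1 / (1 + w / 2)"
      using good[OF X] w by (intro divide_left_mono mult_pos_pos) auto
    finally show "1 / (1 + t X)\<^sup>2 \<le> 1 / (1 + w / 2)" .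
  qed (use tb w in auto)
  then show "shrinkage \<nu> h a N \<le> 1 / (1 + a * real N * v / 2) + 4 * B / real N"
    using PA by (simp add: w_def)
  have "noise_gain \<nu> h a N \<le> 2 / w + mu.prob A"
    unfolding G
  proof (rule mu.expectation_le_except[OF _ Am])
    fix X assume X: "X \<in> space \<mu> - A"
    then have "t X > 0" using good[OF X] w by linarith
    then have "t X / (1 + t X)\<^sup>2 \<le> 1 / t X" by (rule tb)
    also have "\<dots> \<le> 1 / (w / 2)"
      using good[OF X] w by (intro divide_left_mono mult_pos_pos) auto
    finally show "t X / (1 + t X)\<^sup>2 \<le> 2 / w" by simp
  qed (use tb w in auto)
  then show "noise_gain \<nu> h a N \<le> 2 / (a * real N * v) + 4 * B / real N"
    using PA by (simp add: w_def)
  assume "real N \<ge> 8 * B"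
  then have "4 * B / real N \<le> 1 / 2"
    using N by (simp add: pos_divide_le_eq)
  then have half: "1 / 2 \<le> 1 - mu.prob A"
    using PA by linarith
  have "1 / (1 + 3 * w / 2)\<^sup>2 * (1 - mu.prob A) \<le> shrinkage \<nu> h a N"
    unfolding S
  proof (rule mu.expectation_ge_except[OF _ Am])
    fix X assume X: "X \<in> space \<mu> - A"
    show "1 / (1 + 3 * w / 2)\<^sup>2 \<le> 1 / (1 + t X)\<^sup>2"
      using good[OF X] w t0[of X] by (intro divide_left_mono power_mono mult_pos_pos) auto
  qed (use tb w in auto)
  moreover have "1 / (1 + 3 * w / 2)\<^sup>2 * (1 / 2) \<le> 1 / (1 + 3 * w / 2)\<^sup>2 * (1 - mu.prob A)"
    by (intro mult_left_mono half) auto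
  ultimately show "shrinkage \<nu> h a N \<ge> 1 / 2 * (1 / (1 + 3 * (a * real N * v) / 2)\<^sup>2)"
    by (simp add: w_def)
  have "w / 2 / (1 + 3 * w / 2)\<^sup>2 * (1 - mu.prob A) \<le> noise_gain \<nu> h a N"
    unfolding G
  proof (rule mu.expectation_ge_except[OF _ Am])
    fix X assume X: "X \<in> space \<mu> - A"
    show "w / 2 / (1 + 3 * w / 2)\<^sup>2 \<le> t X / (1 + t X)\<^sup>2"
      using good[OF X] w t0[of X] by (intro frac_le power_mono) auto
  qed (use tb w in auto)
  moreover have "w / 2 / (1 + 3 * w / 2)\<^sup>2 * (1 / 2) \<le> w / 2 / (1 + 3 * w / 2)\<^sup>2 * (1 - mu.prob A)"
    using w by (intro mult_left_mono half) auto
  ultimately show "noise_gain \<nu> h a N \<ge> 1 / 2 * (a * real N * v / 2 / (1 + 3 * (a * real N * v) / 2)\<^sup>2)"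
    by (simp add: w_def)
qed

end

section \<open>The expected excess risk as a series\<close>

lemma
  shows integrable_std_normal: "integrable (density lborel (\<lambda>t. ennreal (std_normal_density t))) (\<lambda>t. t)"
    and integral_std_normal: "(\<integral>t. t \<partial>density lborel (\<lambda>t. ennreal (std_normal_density t))) = 0"
    and integrable_std_normal_square:
      "integrable (density lborel (\<lambda>t. ennreal (std_normal_density t))) (\<lambda>t. t * t)"
    and integral_std_normal_square:
      "(\<integral>t. t * t \<partial>density lborel (\<lambda>t. ennreal (std_normal_density t))) = 1"
proof -
  let ?M = "density lborel (\<lambda>t. ennreal (std_normal_density t))"
  have "has_bochner_integral lborel (\<lambda>t. std_normal_density t *\<^sub>R t) 0"
    using std_normal_moment_odd[of 0] by simp
  then have 1: "has_bochner_integral ?M (\<lambda>t. t) 0"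
    by (intro has_bochner_integral_density) auto
  have "has_bochner_integral lborel (\<lambda>t. std_normal_density t *\<^sub>R (t * t)) 1"
    using std_normal_moment_even[of 1] by (simp add: power2_eq_square)
  then have 2: "has_bochner_integral ?M (\<lambda>t. t * t) 1"
    by (intro has_bochner_integral_density) auto
  show "integrable ?M (\<lambda>t. t)" "(\<integral>t. t \<partial>?M) = 0" "integrable ?M (\<lambda>t. t * t)" "(\<integral>t. t * t \<partial>?M) = 1"
    using 1 2 by (auto simp: has_bochner_integral_iff)
qed

text \<open>The error of one eigenvalue is affine in the noise, so averaging over the noise separates
  the bias \<open>l j / (1 + t)\<close> from a variance, where \<open>t = a * energy (\<phi> j) N X\<close> is the random
  signal-to-noise ratio.\<close>

lemma post_mean_error:
  fixes \<phi> :: "nat \<Rightarrow> 'a::real_inner" and \<sigma> :: "nat \<Rightarrow> real"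
  assumes "N \<ge> 1" "j \<ge> 1" "\<gamma> > 0"
  defines "a \<equiv> (\<sigma> j)\<^sup>2 / \<gamma>\<^sup>2"
  shows "l j - post_mean \<phi> \<gamma> \<sigma> N (data_map \<phi> \<gamma> l N (X, \<Xi>)) j =
    (l j - a * \<gamma> * (\<Sum>n=1..N. (\<phi> j \<bullet> X n) * \<Xi> (j, n))) / (1 + a * energy (\<phi> j) N X)"
proof -
  let ?S = "energy (\<phi> j) N X" and ?W = "\<Sum>n=1..N. (\<phi> j \<bullet> X n) * \<Xi> (j, n)"
  define Y where "Y = (\<lambda>i\<in>{1..} \<times> {1..N}. (\<phi> (fst i) \<bullet> X (snd i)) * l (fst i) + \<gamma> * \<Xi> i)"
  have "(\<Sum>n=1..N. Y (j, n) * (\<phi> j \<bullet> X n)) = (\<Sum>n=1..N. l j * (\<phi> j \<bullet> X n)\<^sup>2 + \<gamma> * ((\<phi> j \<bullet> X n) * \<Xi> (j, n)))"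
    using assms(2) by (intro sum.cong) (auto simp: Y_def power2_eq_square algebra_simps)
  also have "\<dots> = l j * ?S + \<gamma> * ?W"
    by (simp add: energy_def sum.distrib sum_distrib_left)
  finally have Y: "(\<Sum>n=1..N. Y (j, n) * (\<phi> j \<bullet> X n)) = l j * ?S + \<gamma> * ?W" .
  have a: "real N / \<gamma>\<^sup>2 * (\<sigma> j)\<^sup>2 * (1 / real N * z) = a * z" for z
    using assms(1) by (simp add: a_def)
  have "post_mean \<phi> \<gamma> \<sigma> N (X, Y) j = a * (l j * ?S + \<gamma> * ?W) / (1 + a * ?S)"
    unfolding post_mean_def prod.case Y a by (simp add: energy_def)
  then have m: "post_mean \<phi> \<gamma> \<sigma> N (data_map \<phi> \<gamma> l N (X, \<Xi>)) j = a * (l j * ?S + \<gamma> * ?W) / (1 + a * ?S)"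
    by (simp add: data_map_def Y_def)
  have "1 + a * ?S > 0"
    using energy_nonneg[of "\<phi> j" N X] by (intro add_pos_nonneg mult_nonneg_nonneg) (auto simp: a_def)
  then show ?thesis
    unfolding m by (simp add: field_simps)
qed

lemma noise_average_square:
  fixes g :: "nat \<Rightarrow> real"
  assumes "j \<ge> 1"
  shows "integrable (noise_law N) (\<lambda>\<Xi>. (u - c * (\<Sum>n=1..N. g n * \<Xi> (j, n)))\<^sup>2)"
    and "(\<integral>\<Xi>. (u - c * (\<Sum>n=1..N. g n * \<Xi> (j, n)))\<^sup>2 \<partial>noise_law N) = u\<^sup>2 + c\<^sup>2 * (\<Sum>n=1..N. (g n)\<^sup>2)"
proof -
  let ?G = "density lborel (\<lambda>t. ennreal (std_normal_density t))"
  have G: "prob_space ?G" by (intro prob_space_normal_density) simp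
  interpret prob_space "noise_law N"
    unfolding noise_law_def by (intro prob_space_PiM G)
  define W where "W \<Xi> = (\<Sum>n\<in>{1..N}. g n * \<Xi> (j, n))" for \<Xi> :: "nat \<times> nat \<Rightarrow> real"
  have i1: "integrable (noise_law N) (\<lambda>\<Xi>. \<Xi> (j, n))"
    and e1: "(\<integral>\<Xi>. \<Xi> (j, n) \<partial>noise_law N) = 0" if "n \<in> {1..N}" for n
    unfolding noise_law_def using that assms G integrable_std_normal integral_std_normal
    by (auto intro!: integrable_PiM_coordinate[where f="\<lambda>t. t"]
        simp: integral_PiM_coordinate[where f="\<lambda>t. t"])
  have ii: "integrable (noise_law N) (\<lambda>\<Xi>. \<Xi> (j, n) * \<Xi> (j, n))"
    and ei: "(\<integral>\<Xi>. (\<Xi> (j, n))\<^sup>2 \<partial>noise_law N) = 1" if "n \<in> {1..N}" for n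
    unfolding noise_law_def power2_eq_square
    using that assms G integrable_std_normal_square integral_std_normal_square
    by (auto intro!: integrable_PiM_coordinate[where f="\<lambda>t. t * t"]
        simp: integral_PiM_coordinate[where f="\<lambda>t. t * t"])
  have int: "integrable (noise_law N) (\<lambda>\<Xi>. \<Xi> (j, m) * \<Xi> (j, n))" if "m \<in> {1..N}" "n \<in> {1..N}" for m n
  proof (cases "m = n")
    case True
    then show ?thesis using ii[OF that(1)] by simp
  next
    case False
    then show ?thesis
      unfolding noise_law_def using that assms G integrable_std_normal
      by (intro integrable_PiM_coordinates_mult[where f="\<lambda>t. t" and g="\<lambda>t. t"]) auto
  qed
  have unc: "(\<integral>\<Xi>. \<Xi> (j, m) * \<Xi> (j, n) \<partial>noise_law N) = 0" if "m \<in> {1..N}" "n \<in> {1..N}" "m \<noteq> n" for m n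
    unfolding noise_law_def using that assms G integrable_std_normal integral_std_normal
    by (subst integral_PiM_coordinates_mult[where f="\<lambda>t. t" and g="\<lambda>t. t"]) auto
  have W1: "integrable (noise_law N) W" "expectation W = 0"
    unfolding W_def[abs_def] using i1 e1 by (auto simp: Bochner_Integration.integral_sum)
  have W2: "integrable (noise_law N) (\<lambda>\<Xi>. (W \<Xi>)\<^sup>2)"
    unfolding W_def by (intro integrable_square_uncorrelated_sum int unc) auto
  have "expectation (\<lambda>\<Xi>. (W \<Xi>)\<^sup>2) = (\<Sum>n\<in>{1..N}. (g n)\<^sup>2 * (\<integral>\<Xi>. (\<Xi> (j, n))\<^sup>2 \<partial>noise_law N))"
    unfolding W_def by (intro integral_square_uncorrelated_sum int unc) auto
  then have W2e: "expectation (\<lambda>\<Xi>. (W \<Xi>)\<^sup>2) = (\<Sum>n=1..N. (g n)\<^sup>2)"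
    by (simp add: ei)
  have sq: "(u - c * W \<Xi>)\<^sup>2 = u\<^sup>2 - (2 * u * c) * W \<Xi> + c\<^sup>2 * (W \<Xi>)\<^sup>2" for \<Xi>
    by algebra
  show "integrable (noise_law N) (\<lambda>\<Xi>. (u - c * (\<Sum>n=1..N. g n * \<Xi> (j, n)))\<^sup>2)"
    unfolding W_def[symmetric] sq using W1 W2 by simp
  show "(\<integral>\<Xi>. (u - c * (\<Sum>n=1..N. g n * \<Xi> (j, n)))\<^sup>2 \<partial>noise_law N) = u\<^sup>2 + c\<^sup>2 * (\<Sum>n=1..N. (g n)\<^sup>2)"
    unfolding W_def[symmetric] sq using W1 W2 W2e by (simp add: prob_space)
qed

lemma noise_average_error:
  fixes \<phi> :: "nat \<Rightarrow> 'a::real_inner" and \<sigma> :: "nat \<Rightarrow> real"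
  assumes "N \<ge> 1" "j \<ge> 1" "\<gamma> > 0"
  defines "a \<equiv> (\<sigma> j)\<^sup>2 / \<gamma>\<^sup>2"
  shows "(\<integral>\<^sup>+\<Xi>. ennreal ((l j - post_mean \<phi> \<gamma> \<sigma> N (data_map \<phi> \<gamma> l N (X, \<Xi>)) j)\<^sup>2) \<partial>noise_law N) =
    ennreal ((l j)\<^sup>2 * (1 / (1 + a * energy (\<phi> j) N X)\<^sup>2)
       + (\<sigma> j)\<^sup>2 * (a * energy (\<phi> j) N X / (1 + a * energy (\<phi> j) N X)\<^sup>2))"
proof -
  let ?S = "energy (\<phi> j) N X" and ?W = "\<lambda>\<Xi>. \<Sum>n=1..N. (\<phi> j \<bullet> X n) * \<Xi> (j, n)"
  note avg = noise_average_square[OF assms(2), of N "l j" "a * \<gamma>" "\<lambda>n. \<phi> j \<bullet> X n"]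
  have "(\<integral>\<^sup>+\<Xi>. ennreal ((l j - post_mean \<phi> \<gamma> \<sigma> N (data_map \<phi> \<gamma> l N (X, \<Xi>)) j)\<^sup>2) \<partial>noise_law N)
    = (\<integral>\<^sup>+\<Xi>. ennreal ((l j - a * \<gamma> * ?W \<Xi>)\<^sup>2 / (1 + a * ?S)\<^sup>2) \<partial>noise_law N)"
    unfolding post_mean_error[OF assms(1-3)] a_def[symmetric] by (simp add: power_divide)
  also have "\<dots> = ennreal (\<integral>\<Xi>. (l j - a * \<gamma> * ?W \<Xi>)\<^sup>2 / (1 + a * ?S)\<^sup>2 \<partial>noise_law N)"
    using avg(1) by (intro nn_integral_eq_integral integrable_divide) auto
  also have "(\<integral>\<Xi>. (l j - a * \<gamma> * ?W \<Xi>)\<^sup>2 / (1 + a * ?S)\<^sup>2 \<partial>noise_law N) =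
      ((l j)\<^sup>2 + (a * \<gamma>)\<^sup>2 * ?S) / (1 + a * ?S)\<^sup>2"
    using avg by (simp add: energy_def)
  also have "(a * \<gamma>)\<^sup>2 * ?S = (\<sigma> j)\<^sup>2 * (a * ?S)"
    using assms(3) by (simp add: a_def power2_eq_square field_simps)
  finally show ?thesis
    by (simp add: add_divide_distrib)
qed

lemma nn_integral_coordinate_series:
  fixes \<nu> :: "'a::{real_inner, banach, second_countable_topology} measure"
  assumes bor [measurable_cong]: "sets \<nu> = sets borel" and int: "integrable \<nu> (\<lambda>x. (norm x)\<^sup>2)"
  shows "(\<integral>\<^sup>+x. (\<Sum>i. ennreal ((c (Suc i))\<^sup>2 * (\<phi> (Suc i) \<bullet> x)\<^sup>2)) \<partial>\<nu>) =
    (\<Sum>i. ennreal ((\<phi> (Suc i) \<bullet> cov_op \<nu> (\<phi> (Suc i))) * (c (Suc i))\<^sup>2))"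
proof -
  have "(\<integral>\<^sup>+x. (\<Sum>i. ennreal ((c (Suc i))\<^sup>2 * (\<phi> (Suc i) \<bullet> x)\<^sup>2)) \<partial>\<nu>) =
      (\<Sum>i. \<integral>\<^sup>+x. ennreal ((c (Suc i))\<^sup>2 * (\<phi> (Suc i) \<bullet> x)\<^sup>2) \<partial>\<nu>)"
    by (intro nn_integral_suminf) measurable
  also have "(\<lambda>i. \<integral>\<^sup>+x. ennreal ((c (Suc i))\<^sup>2 * (\<phi> (Suc i) \<bullet> x)\<^sup>2) \<partial>\<nu>) =
      (\<lambda>i. ennreal ((\<phi> (Suc i) \<bullet> cov_op \<nu> (\<phi> (Suc i))) * (c (Suc i))\<^sup>2))"
  proof
    fix i
    let ?h = "\<phi> (Suc i)"
    have "(\<integral>\<^sup>+x. ennreal ((c (Suc i))\<^sup>2 * (?h \<bullet> x)\<^sup>2) \<partial>\<nu>) = ennreal (\<integral>x. (c (Suc i))\<^sup>2 * (?h \<bullet> x)\<^sup>2 \<partial>\<nu>)"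
      using integrable_inner_mult_inner[OF bor int, of ?h ?h]
      by (intro nn_integral_eq_integral) (auto simp: power2_eq_square)
    then show "(\<integral>\<^sup>+x. ennreal ((c (Suc i))\<^sup>2 * (?h \<bullet> x)\<^sup>2) \<partial>\<nu>) = ennreal ((?h \<bullet> cov_op \<nu> ?h) * (c (Suc i))\<^sup>2)"
      using inner_cov_op[OF bor int, of ?h ?h] by (simp add: power2_eq_square mult.commute)
  qed
  finally show ?thesis .
qed

text \<open>Finite expectation of a series of squares makes the series converge for almost every \<open>x\<close>, so
  the infinite value outside the domains of the operators occurs with probability zero.\<close>

lemma nn_integral_sq_error:
  fixes \<nu> :: "'a::{real_inner, banach, second_countable_topology} measure"
  assumes bor [measurable_cong]: "sets \<nu> = sets borel" and int: "integrable \<nu> (\<lambda>x. (norm x)\<^sup>2)"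
    and on: "\<forall>i\<ge>1. \<forall>j\<ge>1. \<phi> i \<bullet> \<phi> j = (if i = j then 1 else 0)"
    and l: "(\<Sum>i. ennreal ((\<phi> (Suc i) \<bullet> cov_op \<nu> (\<phi> (Suc i))) * (l (Suc i))\<^sup>2)) \<noteq> \<infinity>"
    and d: "(\<Sum>i. ennreal ((\<phi> (Suc i) \<bullet> cov_op \<nu> (\<phi> (Suc i))) * (l (Suc i) - m (Suc i))\<^sup>2)) \<noteq> \<infinity>"
  shows "(\<integral>\<^sup>+x. sq_error \<phi> l m x \<partial>\<nu>) =
    (\<Sum>i. ennreal ((\<phi> (Suc i) \<bullet> cov_op \<nu> (\<phi> (Suc i))) * (l (Suc i) - m (Suc i))\<^sup>2))"
proof -
  have ae: "AE x in \<nu>. (\<lambda>j. (c j)\<^sup>2 * (\<phi> j \<bullet> x)\<^sup>2) summable_on {1..}"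
    if "(\<Sum>i. ennreal ((\<phi> (Suc i) \<bullet> cov_op \<nu> (\<phi> (Suc i))) * (c (Suc i))\<^sup>2)) \<noteq> \<infinity>" for c
  proof -
    have "AE x in \<nu>. (\<Sum>i. ennreal ((c (Suc i))\<^sup>2 * (\<phi> (Suc i) \<bullet> x)\<^sup>2)) \<noteq> \<infinity>"
      using that unfolding nn_integral_coordinate_series[OF bor int, symmetric]
      by (intro nn_integral_noteq_infinite) measurable
    then show ?thesis
      by eventually_elim (rule summable_on_if_suminf_ennreal_Suc; simp)
  qed
  have "(\<integral>\<^sup>+x. sq_error \<phi> l m x \<partial>\<nu>) =
      (\<integral>\<^sup>+x. (\<Sum>i. ennreal ((l (Suc i) - m (Suc i))\<^sup>2 * (\<phi> (Suc i) \<bullet> x)\<^sup>2)) \<partial>\<nu>)"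
    using ae[OF l] ae[of "\<lambda>j. l j - m j", OF d]
    by (intro nn_integral_cong_AE, eventually_elim)
       (rule sq_error_eq_series[OF on]; simp add: diag_dom_def)
  also have "\<dots> = (\<Sum>i. ennreal ((\<phi> (Suc i) \<bullet> cov_op \<nu> (\<phi> (Suc i))) * (l (Suc i) - m (Suc i))\<^sup>2))"
    by (rule nn_integral_coordinate_series[OF bor int, of "\<lambda>j. l j - m j"])
  finally show ?thesis .
qed

lemma borel_measurable_post_mean:
  fixes \<phi> :: "nat \<Rightarrow> 'a::{real_inner, second_countable_topology}"
  assumes "j \<ge> 1"
  shows "(\<lambda>D. post_mean \<phi> \<gamma> \<sigma> N D j) \<in> borel_measurable
    (PiM {1..N} (\<lambda>_. borel) \<Otimes>\<^sub>M PiM ({1..} \<times> {1..N}) (\<lambda>_. borel))"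
proof -
  let ?M = "PiM {1..N} (\<lambda>_. borel) \<Otimes>\<^sub>M PiM ({1..} \<times> {1..N}) (\<lambda>_. borel) :: ((nat \<Rightarrow> 'a) \<times> (nat \<times> nat \<Rightarrow> real)) measure"
  have 1: "(\<lambda>D. \<phi> j \<bullet> fst D n) \<in> borel_measurable ?M" if "n \<in> {1..N}" for n
  proof (rule borel_measurable_inner)
    show "(\<lambda>D. fst D n) \<in> borel_measurable ?M"
      using that by (intro measurable_compose[OF measurable_fst measurable_component_singleton])
  qed simp
  have 2: "(\<lambda>D. snd D (j, n)) \<in> borel_measurable ?M" if "n \<in> {1..N}" for n
    using that assms by (intro measurable_compose[OF measurable_snd measurable_component_singleton]) auto
  have [measurable]: "(\<lambda>D. \<Sum>n=1..N. snd D (j, n) * (\<phi> j \<bullet> fst D n)) \<in> borel_measurable ?M"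
    by (intro borel_measurable_sum borel_measurable_times 1 2)
  have [measurable]: "(\<lambda>D. \<Sum>n=1..N. (\<phi> j \<bullet> fst D n)\<^sup>2) \<in> borel_measurable ?M"
    by (intro borel_measurable_sum borel_measurable_power 1)
  show ?thesis
    unfolding post_mean_def case_prod_beta by measurable
qed

definition risk_term ::
  "(nat \<Rightarrow> 'a::{real_inner, banach, second_countable_topology}) \<Rightarrow> 'a measure \<Rightarrow> real \<Rightarrow>
   (nat \<Rightarrow> real) \<Rightarrow> (nat \<Rightarrow> real) \<Rightarrow> nat \<Rightarrow> nat \<Rightarrow> real" where
  "risk_term \<phi> \<nu> \<gamma> l \<sigma> N j = (\<phi> j \<bullet> cov_op \<nu> (\<phi> j)) *
     ((l j)\<^sup>2 * shrinkage \<nu> (\<phi> j) ((\<sigma> j)\<^sup>2 / \<gamma>\<^sup>2) N + (\<sigma> j)\<^sup>2 * noise_gain \<nu> (\<phi> j) ((\<sigma> j)\<^sup>2 / \<gamma>\<^sup>2) N)"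

lemma nn_integral_data_law_error:
  fixes \<phi> :: "nat \<Rightarrow> 'a::{real_inner, banach, second_countable_topology}"
  assumes nu: "prob_space \<nu>" and bor [measurable_cong]: "sets \<nu> = sets borel"
    and "N \<ge> 1" "j \<ge> 1" "\<gamma> > 0" and th: "\<phi> j \<bullet> cov_op \<nu> (\<phi> j) \<ge> 0"
  shows "(\<integral>\<^sup>+D. ennreal ((\<phi> j \<bullet> cov_op \<nu> (\<phi> j)) * (l j - post_mean \<phi> \<gamma> \<sigma> N D j)\<^sup>2) \<partial>data_law \<phi> \<nu> \<gamma> l N)
    = ennreal (risk_term \<phi> \<nu> \<gamma> l \<sigma> N j)"
proof -
  let ?S = "density lborel (\<lambda>t. ennreal (std_normal_density t))"
  define a where "a = (\<sigma> j)\<^sup>2 / \<gamma>\<^sup>2"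
  define \<theta> where "\<theta> = \<phi> j \<bullet> cov_op \<nu> (\<phi> j)"
  have a: "a \<ge> 0" by (simp add: a_def)
  have [measurable_cong]: "sets (sample_law \<nu> N) = sets (PiM {1..N} (\<lambda>_. borel))"
    unfolding sample_law_def by (intro sets_PiM_cong) (auto simp: bor)
  have [measurable_cong]: "sets (noise_law N) = sets (PiM ({1..} \<times> {1..N}) (\<lambda>_. borel))"
    unfolding noise_law_def by (intro sets_PiM_cong) auto
  interpret A: prob_space "sample_law \<nu> N"
    unfolding sample_law_def by (intro prob_space_PiM nu)
  interpret B: prob_space "noise_law N"
    unfolding noise_law_def by (intro prob_space_PiM prob_space_normal_density) simp
  have dm: "data_map \<phi> \<gamma> l N \<in> sample_law \<nu> N \<Otimes>\<^sub>M noise_law N \<rightarrow>\<^sub>M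
      PiM {1..N} (\<lambda>_. borel) \<Otimes>\<^sub>M PiM ({1..} \<times> {1..N}) (\<lambda>_. borel)"
    unfolding data_map_def case_prod_beta
    by (intro measurable_Pair measurable_restrict) (measurable, auto)
  note pm [measurable] = borel_measurable_post_mean[OF assms(4), of \<phi> \<gamma> \<sigma> N]
  have em: "(\<lambda>D. ennreal (\<theta> * (l j - post_mean \<phi> \<gamma> \<sigma> N D j)\<^sup>2)) \<in> borel_measurable
    (PiM {1..N} (\<lambda>_. borel) \<Otimes>\<^sub>M PiM ({1..} \<times> {1..N}) (\<lambda>_. borel))"
    by measurable
  let ?b = "\<lambda>X. 1 / (1 + a * energy (\<phi> j) N X)\<^sup>2"
    and ?v = "\<lambda>X. a * energy (\<phi> j) N X / (1 + a * energy (\<phi> j) N X)\<^sup>2"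
  have t0: "a * energy (\<phi> j) N X \<ge> 0" for X
    using a energy_nonneg by (rule mult_nonneg_nonneg)
  note tb = inverse_square_bounds[OF t0]
  have [measurable]: "energy (\<phi> j) N \<in> borel_measurable (sample_law \<nu> N)"
    by (rule borel_measurable_energy[OF bor])
  have nb: "norm (?b X) \<le> 1" "norm (?v X) \<le> 1" for X
    unfolding real_norm_def abs_of_nonneg[OF tb(1)] abs_of_nonneg[OF tb(3)] by (rule tb)+
  have ib: "integrable (sample_law \<nu> N) ?b"
    by (intro A.integrable_const_bound[where B=1] AE_I2 nb) measurable
  have iv: "integrable (sample_law \<nu> N) ?v"
    by (intro A.integrable_const_bound[where B=1] AE_I2 nb) measurable
  have "(\<integral>\<^sup>+D. ennreal (\<theta> * (l j - post_mean \<phi> \<gamma> \<sigma> N D j)\<^sup>2) \<partial>data_law \<phi> \<nu> \<gamma> l N)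
     = (\<integral>\<^sup>+D. ennreal (\<theta> * (l j - post_mean \<phi> \<gamma> \<sigma> N (data_map \<phi> \<gamma> l N D) j)\<^sup>2)
          \<partial>(sample_law \<nu> N \<Otimes>\<^sub>M noise_law N))"
    unfolding data_law_def using em by (intro nn_integral_distr[OF dm]) simp
  also have "\<dots> = (\<integral>\<^sup>+X. \<integral>\<^sup>+\<Xi>. ennreal (\<theta> * (l j - post_mean \<phi> \<gamma> \<sigma> N (data_map \<phi> \<gamma> l N (X, \<Xi>)) j)\<^sup>2)
          \<partial>noise_law N \<partial>sample_law \<nu> N)"
    using measurable_compose[OF dm em] by (intro B.nn_integral_fst[symmetric]) simp
  also have "\<dots> = (\<integral>\<^sup>+X. ennreal (\<theta> * ((l j)\<^sup>2 * ?b X + (\<sigma> j)\<^sup>2 * ?v X)) \<partial>sample_law \<nu> N)"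
  proof (rule nn_integral_cong)
    fix X assume X: "X \<in> space (sample_law \<nu> N)"
    have m: "(\<lambda>\<Xi>. ennreal ((l j - post_mean \<phi> \<gamma> \<sigma> N (data_map \<phi> \<gamma> l N (X, \<Xi>)) j)\<^sup>2))
        \<in> borel_measurable (noise_law N)"
    proof -
      have "(\<lambda>\<Xi>. data_map \<phi> \<gamma> l N (X, \<Xi>)) \<in> noise_law N \<rightarrow>\<^sub>M
        PiM {1..N} (\<lambda>_. borel) \<Otimes>\<^sub>M PiM ({1..} \<times> {1..N}) (\<lambda>_. borel)"
        by (rule measurable_compose[OF measurable_Pair1'[OF X] dm])
      from measurable_compose[OF this pm] show ?thesis
        by measurable
    qed
    have "(\<integral>\<^sup>+\<Xi>. ennreal (\<theta> * (l j - post_mean \<phi> \<gamma> \<sigma> N (data_map \<phi> \<gamma> l N (X, \<Xi>)) j)\<^sup>2) \<partial>noise_law N)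
      = ennreal \<theta> * (\<integral>\<^sup>+\<Xi>. ennreal ((l j - post_mean \<phi> \<gamma> \<sigma> N (data_map \<phi> \<gamma> l N (X, \<Xi>)) j)\<^sup>2) \<partial>noise_law N)"
      using th m by (subst nn_integral_cmult[symmetric]) (auto simp: \<theta>_def ennreal_mult)
    also have "\<dots> = ennreal (\<theta> * ((l j)\<^sup>2 * ?b X + (\<sigma> j)\<^sup>2 * ?v X))"
      unfolding noise_average_error[OF assms(3-5)] a_def[symmetric]
      using th unfolding \<theta>_def
      by (intro ennreal_mult[symmetric] add_nonneg_nonneg mult_nonneg_nonneg[OF zero_le_power2] tb)
    finally show "(\<integral>\<^sup>+\<Xi>. ennreal (\<theta> * (l j - post_mean \<phi> \<gamma> \<sigma> N (data_map \<phi> \<gamma> l N (X, \<Xi>)) j)\<^sup>2) \<partial>noise_law N)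
      = ennreal (\<theta> * ((l j)\<^sup>2 * ?b X + (\<sigma> j)\<^sup>2 * ?v X))" .
  qed
  also have "\<dots> = ennreal (\<integral>X. \<theta> * ((l j)\<^sup>2 * ?b X + (\<sigma> j)\<^sup>2 * ?v X) \<partial>sample_law \<nu> N)"
    using ib iv th tb
    by (intro nn_integral_eq_integral AE_I2 integrable_mult_right Bochner_Integration.integrable_add
        mult_nonneg_nonneg add_nonneg_nonneg) (auto simp: \<theta>_def)
  also have "(\<integral>X. \<theta> * ((l j)\<^sup>2 * ?b X + (\<sigma> j)\<^sup>2 * ?v X) \<partial>sample_law \<nu> N) = risk_term \<phi> \<nu> \<gamma> l \<sigma> N j"
  proof -
    have "(\<integral>X. \<theta> * ((l j)\<^sup>2 * ?b X + (\<sigma> j)\<^sup>2 * ?v X) \<partial>sample_law \<nu> N) =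
      \<theta> * ((l j)\<^sup>2 * (\<integral>X. ?b X \<partial>sample_law \<nu> N) + (\<sigma> j)\<^sup>2 * (\<integral>X. ?v X \<partial>sample_law \<nu> N))"
      unfolding integral_mult_right_zero
      by (subst Bochner_Integration.integral_add)
         (intro integrable_mult_right ib iv, intro integrable_mult_right ib iv, unfold integral_mult_right_zero, rule refl)
    then show ?thesis
      unfolding risk_term_def shrinkage_def noise_gain_def a_def[symmetric] \<theta>_def[symmetric] .
  qed
  finally show ?thesis
    unfolding \<theta>_def .
qed

text \<open>The mean over \<open>D\<close> of the series of squared errors is computed first.  As it is finite, the
  series is finite for almost every \<open>D\<close>, which is what identifying it with the risk at \<open>D\<close>
  requires.\<close>

lemma expected_excess_risk_eq_series:
  fixes \<phi> :: "nat \<Rightarrow> 'a::{real_inner, banach, second_countable_topology}"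
  assumes nu: "prob_space \<nu>" and bor [measurable_cong]: "sets \<nu> = sets borel"
    and int: "integrable \<nu> (\<lambda>x. (norm x)\<^sup>2)"
    and on: "\<forall>i\<ge>1. \<forall>j\<ge>1. \<phi> i \<bullet> \<phi> j = (if i = j then 1 else 0)"
    and "N \<ge> 1" "\<gamma> > 0" and th: "\<And>j. \<phi> j \<bullet> cov_op \<nu> (\<phi> j) \<ge> 0"
    and l: "(\<lambda>j. (\<phi> j \<bullet> cov_op \<nu> (\<phi> j)) * (l j)\<^sup>2) summable_on {1..}"
    and r0: "\<And>j. j \<ge> 1 \<Longrightarrow> risk_term \<phi> \<nu> \<gamma> l \<sigma> N j \<ge> 0"
    and r: "risk_term \<phi> \<nu> \<gamma> l \<sigma> N summable_on {1..}"
  shows "expected_excess_risk \<phi> \<nu> \<gamma> l \<sigma> N = ennreal (\<Sum>\<^sub>\<infinity>j\<in>{1..}. risk_term \<phi> \<nu> \<gamma> l \<sigma> N j)"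
proof -
  let ?P = "PiM {1..N} (\<lambda>_. borel) \<Otimes>\<^sub>M PiM ({1..} \<times> {1..N}) (\<lambda>_. borel) :: ((nat \<Rightarrow> 'a) \<times> (nat \<times> nat \<Rightarrow> real)) measure"
  define e where "e j D = ennreal ((\<phi> j \<bullet> cov_op \<nu> (\<phi> j)) * (l j - post_mean \<phi> \<gamma> \<sigma> N D j)\<^sup>2)" for j D
  have [measurable_cong]: "sets (data_law \<phi> \<nu> \<gamma> l N) = sets ?P"
    by (simp add: data_law_def)
  have em: "e (Suc i) \<in> borel_measurable (data_law \<phi> \<nu> \<gamma> l N)" for i
  proof -
    have [measurable]: "(\<lambda>D. post_mean \<phi> \<gamma> \<sigma> N D (Suc i)) \<in> borel_measurable ?P"
      by (rule borel_measurable_post_mean) simp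
    show ?thesis
      unfolding e_def[abs_def] by measurable
  qed
  have "(\<integral>\<^sup>+D. (\<Sum>i. e (Suc i) D) \<partial>data_law \<phi> \<nu> \<gamma> l N) = (\<Sum>i. \<integral>\<^sup>+D. e (Suc i) D \<partial>data_law \<phi> \<nu> \<gamma> l N)"
    by (intro nn_integral_suminf em)
  also have "\<dots> = (\<Sum>i. ennreal (risk_term \<phi> \<nu> \<gamma> l \<sigma> N (Suc i)))"
    unfolding e_def using assms by (subst nn_integral_data_law_error) auto
  also have "\<dots> = ennreal (\<Sum>\<^sub>\<infinity>j\<in>{1..}. risk_term \<phi> \<nu> \<gamma> l \<sigma> N j)"
    using r0 r by (rule suminf_ennreal_Suc_eq_infsum)
  finally have tot: "(\<integral>\<^sup>+D. (\<Sum>i. e (Suc i) D) \<partial>data_law \<phi> \<nu> \<gamma> l N) =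
    ennreal (\<Sum>\<^sub>\<infinity>j\<in>{1..}. risk_term \<phi> \<nu> \<gamma> l \<sigma> N j)" .
  have fin: "AE D in data_law \<phi> \<nu> \<gamma> l N. (\<Sum>i. e (Suc i) D) \<noteq> \<infinity>"
    using em tot by (intro nn_integral_noteq_infinite borel_measurable_suminf) auto
  have lfin: "(\<Sum>i. ennreal ((\<phi> (Suc i) \<bullet> cov_op \<nu> (\<phi> (Suc i))) * (l (Suc i))\<^sup>2)) \<noteq> \<infinity>"
    using th by (subst suminf_ennreal_Suc_eq_infsum[OF _ l]) auto
  have "expected_excess_risk \<phi> \<nu> \<gamma> l \<sigma> N = (\<integral>\<^sup>+D. (\<Sum>i. e (Suc i) D) \<partial>data_law \<phi> \<nu> \<gamma> l N)"
    unfolding expected_excess_risk_def using fin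
  proof (intro nn_integral_cong_AE, eventually_elim)
    case (elim D)
    then show ?case
      unfolding e_def by (intro nn_integral_sq_error[OF bor int on lfin]) simp
  qed
  then show ?thesis
    using tot by simp
qed

section \<open>Sums balanced at the truncation level\<close>

text \<open>Telescoping comparison with the antiderivative of \<open>x powr - r\<close>.\<close>

lemma powr_tail_sum:
  fixes r :: real
  assumes r: "r > 1" and J: "J \<ge> 1"
  shows "(\<lambda>j. real j powr - r) summable_on {J<..}"
    and "(\<Sum>\<^sub>\<infinity>j\<in>{J<..}. real j powr - r) \<le> real J powr (1 - r) / (r - 1)"
proof -
  define F where "F x = x powr (1 - r) / (r - 1)" for x :: real
  have decr: "real j powr - r \<le> F (real j - 1) - F (real j)" if "j > 1" for j
  proof -
    have "\<exists>z::real>real j - 1. z < real j \<and> F (real j) - F (real j - 1) = (real j - (real j - 1)) * - (z powr - r)"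
    proof (rule MVT2)
      fix x assume "real j - 1 \<le> x" "x \<le> real j"
      then have "x > 0" using that by simp
      then have "(F has_real_derivative ((1 - r) * x powr (1 - r - 1)) / (r - 1)) (at x)"
        unfolding F_def[abs_def] by (intro DERIV_cdivide has_real_derivative_powr)
      also have "((1 - r) * x powr (1 - r - 1)) / (r - 1) = - (x powr - r)"
        using r by (simp add: field_simps)
      finally show "(F has_real_derivative - (x powr - r)) (at x)" .
    qed simp
    then obtain z where z: "z > real j - 1" "z < real j" "F (real j) - F (real j - 1) = - (z powr - r)"
      by auto
    have "real j powr - r \<le> z powr - r"
      using z that r by (intro powr_mono2') auto
    then show ?thesis using z(3) by linarith
  qed
  have tel: "(\<Sum>j\<in>{J<..n}. real j powr - r) \<le> F (real J) - F (real n)" if "n \<ge> J" for n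
    using that
  proof (induction n rule: dec_induct)
    case (step n)
    have "{J<..Suc n} = insert (Suc n) {J<..n}" using step.hyps by auto
    then show ?case
      using step.IH decr[of "Suc n"] step.hyps J by simp
  qed simp
  have F0: "F x \<ge> 0" for x using r by (simp add: F_def)
  have bound: "sum (\<lambda>j. real j powr - r) X \<le> F (real J)" if X: "finite X" "X \<subseteq> {J<..}" for X
  proof -
    define n where "n = Max (insert J X)"
    have n: "n \<ge> J" "X \<subseteq> {J<..n}"
      using X by (auto simp: n_def)
    have "sum (\<lambda>j. real j powr - r) X \<le> (\<Sum>j\<in>{J<..n}. real j powr - r)"
      using n by (intro sum_mono2) auto
    also have "\<dots> \<le> F (real J)"
      using tel[OF n(1)] F0[of "real n"] by linarith
    finally show ?thesis .
  qed
  show s: "(\<lambda>j. real j powr - r) summable_on {J<..}"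
    using bound by (intro nonneg_bdd_above_summable_on) (auto simp: bdd_above_def)
  show "(\<Sum>\<^sub>\<infinity>j\<in>{J<..}. real j powr - r) \<le> real J powr (1 - r) / (r - 1)"
    using infsum_le_finite_sums[OF s bound] by (simp add: F_def)
qed

lemma infsum_split_at:
  fixes f :: "nat \<Rightarrow> real"
  assumes "f summable_on {1..}"
  shows "(\<Sum>\<^sub>\<infinity>j\<in>{1..}. f j) = (\<Sum>j=1..J. f j) + (\<Sum>\<^sub>\<infinity>j\<in>{J<..}. f j)"
proof -
  have "f summable_on {J<..}"
    by (rule summable_on_subset_banach[OF assms]) auto
  then have "infsum f ({1..J} \<union> {J<..}) = infsum f {1..J} + infsum f {J<..}"
    by (intro infsum_Un_disjoint) auto
  moreover have "{1..J} \<union> {J<..} = {1..}" by auto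
  ultimately show ?thesis by simp
qed

text \<open>The asymptotic analysis is deterministic.  Here \<open>\<theta>\<close> and \<open>s2\<close> are the training and prior
  variances, \<open>z N j\<close> is the mean signal-to-noise ratio, and \<open>b\<close> and \<open>v\<close> are the averaged factors
  of bias and variance, known through bounds in terms of \<open>z\<close>.\<close>

locale balanced_risk =
  fixes \<theta> s2 l :: "nat \<Rightarrow> real" and b v z :: "nat \<Rightarrow> nat \<Rightarrow> real"
    and \<gamma> B \<alpha> p s c\<^sub>\<theta> C\<^sub>\<theta> c\<^sub>\<sigma> C\<^sub>\<sigma> :: real
  assumes \<gamma>: "\<gamma> > 0" and B: "B > 0"
    and pos: "c\<^sub>\<theta> > 0" "C\<^sub>\<theta> > 0" "c\<^sub>\<sigma> > 0" "C\<^sub>\<sigma> > 0"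
    and \<theta>: "\<And>j. j \<ge> 1 \<Longrightarrow> c\<^sub>\<theta> * real j powr (- 2 * \<alpha>) \<le> \<theta> j" "\<And>j. j \<ge> 1 \<Longrightarrow> \<theta> j \<le> C\<^sub>\<theta> * real j powr (- 2 * \<alpha>)"
    and s2: "\<And>j. j \<ge> 1 \<Longrightarrow> c\<^sub>\<sigma> * real j powr (- 2 * p) \<le> s2 j" "\<And>j. j \<ge> 1 \<Longrightarrow> s2 j \<le> C\<^sub>\<sigma> * real j powr (- 2 * p)"
    and as: "\<alpha> + s > 0" and ap: "\<alpha> + p > 1 / 2"
    and l: "(\<lambda>j. real j powr (2 * s) * (l j)\<^sup>2) summable_on {1..}"
    and z: "\<And>N j. z N j = s2 j / \<gamma>\<^sup>2 * real N * \<theta> j"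
    and b01: "\<And>N j. N \<ge> 1 \<Longrightarrow> j \<ge> 1 \<Longrightarrow> 0 \<le> b N j" "\<And>N j. N \<ge> 1 \<Longrightarrow> j \<ge> 1 \<Longrightarrow> b N j \<le> 1"
    and b_le: "\<And>N j. N \<ge> 1 \<Longrightarrow> j \<ge> 1 \<Longrightarrow> b N j \<le> 1 / (1 + z N j / 2) + 4 * B / real N"
    and b_ge: "\<And>N j. N \<ge> 1 \<Longrightarrow> j \<ge> 1 \<Longrightarrow> real N \<ge> 8 * B \<Longrightarrow> b N j \<ge> 1 / 2 * (1 / (1 + 3 * z N j / 2)\<^sup>2)"
    and v01: "\<And>N j. N \<ge> 1 \<Longrightarrow> j \<ge> 1 \<Longrightarrow> 0 \<le> v N j" "\<And>N j. N \<ge> 1 \<Longrightarrow> j \<ge> 1 \<Longrightarrow> v N j \<le> 1"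
    and v_le: "\<And>N j. N \<ge> 1 \<Longrightarrow> j \<ge> 1 \<Longrightarrow> v N j \<le> 2 / z N j + 4 * B / real N"
    and v_ge: "\<And>N j. N \<ge> 1 \<Longrightarrow> j \<ge> 1 \<Longrightarrow> real N \<ge> 8 * B \<Longrightarrow> v N j \<ge> 1 / 2 * (z N j / 2 / (1 + 3 * z N j / 2)\<^sup>2)"
begin

abbreviation "q \<equiv> \<alpha> + p"

text \<open>As \<open>z N j\<close> is of order \<open>N * j powr (- 2 * q)\<close>, the level is the index up to which the data dominate
  the prior.\<close>

definition level :: "nat \<Rightarrow> nat" where
  "level N = nat \<lfloor>real N powr (1 / (2 * q))\<rfloor>"

definition rate :: "nat \<Rightarrow> real" where
  "rate N = real N powr (- ((q - 1 / 2) / q))"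

lemma \<theta>_pos: "j \<ge> 1 \<Longrightarrow> \<theta> j > 0"
  using \<theta>(1)[of j] pos by (smt (verit) mult_pos_pos of_nat_0_less_iff powr_gt_zero less_le_trans zero_less_one)

lemma s2_pos: "j \<ge> 1 \<Longrightarrow> s2 j > 0"
  using s2(1)[of j] pos by (smt (verit) mult_pos_pos of_nat_0_less_iff powr_gt_zero less_le_trans zero_less_one)

lemma \<theta>_nonneg: "j \<ge> 1 \<Longrightarrow> 0 \<le> \<theta> j" and s2_nonneg: "j \<ge> 1 \<Longrightarrow> 0 \<le> s2 j"
  by (simp_all add: less_imp_le \<theta>_pos s2_pos)

lemma z_pos: "N \<ge> 1 \<Longrightarrow> j \<ge> 1 \<Longrightarrow> z N j > 0"
  unfolding z using \<gamma> s2_pos[of j] \<theta>_pos[of j] by simp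

lemma \<theta>s2_bounds:
  assumes "j \<ge> 1"
  shows "c\<^sub>\<theta> * c\<^sub>\<sigma> * real j powr (- (2 * q)) \<le> \<theta> j * s2 j"
    and "\<theta> j * s2 j \<le> C\<^sub>\<theta> * C\<^sub>\<sigma> * real j powr (- (2 * q))"
proof -
  have e: "real j powr (- (2 * q)) = real j powr (- 2 * \<alpha>) * real j powr (- 2 * p)"
    by (simp add: powr_add[symmetric] algebra_simps)
  have "(c\<^sub>\<theta> * real j powr (- 2 * \<alpha>)) * (c\<^sub>\<sigma> * real j powr (- 2 * p)) \<le> \<theta> j * s2 j"
    using \<theta>(1)[OF assms] s2(1)[OF assms] \<theta>_pos[OF assms] pos by (intro mult_mono) auto
  then show "c\<^sub>\<theta> * c\<^sub>\<sigma> * real j powr (- (2 * q)) \<le> \<theta> j * s2 j"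
    unfolding e by (simp add: mult_ac)
  have "\<theta> j * s2 j \<le> (C\<^sub>\<theta> * real j powr (- 2 * \<alpha>)) * (C\<^sub>\<sigma> * real j powr (- 2 * p))"
    using \<theta>(2)[OF assms] s2(2)[OF assms] s2_pos[OF assms] pos by (intro mult_mono) auto
  then show "\<theta> j * s2 j \<le> C\<^sub>\<theta> * C\<^sub>\<sigma> * real j powr (- (2 * q))"
    unfolding e by (simp add: mult_ac)
qed

lemma summable_\<theta>l: "(\<lambda>j. \<theta> j * (l j)\<^sup>2) summable_on {1..}"
proof (rule summable_on_comparison_test)
  show "(\<lambda>j. C\<^sub>\<theta> * (real j powr (2 * s) * (l j)\<^sup>2)) summable_on {1..}"
    by (intro summable_on_cmult_right l)
  fix j :: nat assume "j \<in> {1..}"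
  then have j: "j \<ge> 1" by simp
  have "real j powr (- 2 * \<alpha>) \<le> real j powr (2 * s)"
    using j as by (intro powr_mono) auto
  then have "\<theta> j \<le> C\<^sub>\<theta> * real j powr (2 * s)"
    using \<theta>(2)[OF j] pos by (smt (verit) mult_left_mono)
  then show "\<theta> j * (l j)\<^sup>2 \<le> C\<^sub>\<theta> * (real j powr (2 * s) * (l j)\<^sup>2)"
    by (metis mult.assoc mult_right_mono zero_le_power2)
  show "0 \<le> \<theta> j * (l j)\<^sup>2" using \<theta>_pos[OF j] by simp
qed

lemma summable_\<theta>s2: "(\<lambda>j. \<theta> j * s2 j) summable_on {1..}"
proof (rule summable_on_comparison_test)
  have "(\<lambda>j. real j powr - (2 * q)) summable_on {1<..}"
    using ap by (intro powr_tail_sum) auto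
  then have "(\<lambda>j. real j powr - (2 * q)) summable_on (insert 1 {1<..})"
    by (simp add: summable_on_insert_iff)
  moreover have "insert 1 {1<..} = {1::nat..}" by auto
  ultimately show "(\<lambda>j. C\<^sub>\<theta> * C\<^sub>\<sigma> * real j powr (- (2 * q))) summable_on {1..}"
    by (intro summable_on_cmult_right) simp
qed (use \<theta>s2_bounds in \<open>auto intro!: mult_nonneg_nonneg \<theta>_nonneg s2_nonneg\<close>)

lemma summable_bias: "N \<ge> 1 \<Longrightarrow> (\<lambda>j. \<theta> j * (l j)\<^sup>2 * b N j) summable_on {1..}"
  by (rule summable_on_comparison_test[OF summable_\<theta>l])
     (auto intro!: mult_nonneg_nonneg mult_left_le b01 \<theta>_nonneg)

lemma summable_variance: "N \<ge> 1 \<Longrightarrow> (\<lambda>j. \<theta> j * s2 j * v N j) summable_on {1..}"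
  by (rule summable_on_comparison_test[OF summable_\<theta>s2])
     (auto intro!: mult_nonneg_nonneg mult_left_le v01 \<theta>_nonneg s2_nonneg)

lemma level_bounds:
  assumes "N \<ge> 1"
  shows "level N \<ge> 1" "real (level N) \<le> real N powr (1 / (2 * q))"
    "real N powr (1 / (2 * q)) < real (level N) + 1"
    "real N powr (1 / (2 * q)) / 2 \<le> real (level N)"
proof -
  let ?M = "real N powr (1 / (2 * q))"
  have M: "?M \<ge> 1" using assms ap by (intro ge_one_powr_ge_zero) auto
  have f: "real (level N) = of_int \<lfloor>?M\<rfloor>"
    using M by (simp add: level_def)
  have "1 \<le> \<lfloor>?M\<rfloor>" using M by (simp add: le_floor_iff)
  then show 1: "level N \<ge> 1" unfolding level_def by linarith
  show "real (level N) \<le> ?M" "?M < real (level N) + 1"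
    unfolding f by linarith+
  then show "?M / 2 \<le> real (level N)" using 1 by linarith
qed

lemma rate_eq:
  assumes "N \<ge> 1"
  shows "rate N = real N powr (1 / (2 * q)) / real N"
    and "rate N = (real N powr (1 / (2 * q))) powr (1 - 2 * q)"
    and "1 / real N \<le> rate N"
proof -
  have e: "- ((q - 1 / 2) / q) = 1 / (2 * q) - 1" "1 / (2 * q) * (1 - 2 * q) = 1 / (2 * q) - 1"
    using ap by (simp_all add: field_simps)
  show 1: "rate N = real N powr (1 / (2 * q)) / real N"
    using assms unfolding rate_def e(1) by (simp add: powr_diff)
  show "rate N = (real N powr (1 / (2 * q))) powr (1 - 2 * q)"
    unfolding powr_powr e(2) rate_def e(1) ..
  have "real N powr (1 / (2 * q)) \<ge> 1"
    using assms ap by (intro ge_one_powr_ge_zero) auto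
  then show "1 / real N \<le> rate N"
    unfolding 1 by (intro divide_right_mono) auto
qed

text \<open>Up to the level every eigenvalue contributes at most a multiple of \<open>1 / N\<close>, apart from the
  summable effect of the exceptional event; beyond it the tail of the series of \<open>\<theta> j * s2 j\<close> has the
  same order as \<open>level N / N\<close>.\<close>

lemma variance_le:
  obtains K where "K \<ge> 0" "\<And>N. N \<ge> 1 \<Longrightarrow> (\<Sum>\<^sub>\<infinity>j\<in>{1..}. \<theta> j * s2 j * v N j) \<le> K * rate N"
proof -
  define D where "D = (\<Sum>\<^sub>\<infinity>j\<in>{1..}. \<theta> j * s2 j)"
  define T where "T = C\<^sub>\<theta> * C\<^sub>\<sigma> * (2 powr (2 * q - 1) / (2 * q - 1))"
  have D: "D \<ge> 0" unfolding D_def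
    by (intro infsum_nonneg mult_nonneg_nonneg) (auto intro!: \<theta>_nonneg s2_nonneg)
  have T: "T \<ge> 0" using pos ap by (simp add: T_def)
  show thesis
  proof (rule that[of "2 * \<gamma>\<^sup>2 + 4 * B * D + T"])
    show "0 \<le> 2 * \<gamma>\<^sup>2 + 4 * B * D + T" using B D T by simp
    fix N :: nat assume N: "N \<ge> 1"
    let ?J = "level N" and ?f = "\<lambda>j. \<theta> j * s2 j * v N j"
    have J: "?J \<ge> 1" using level_bounds[OF N] by simp
    have "(\<Sum>j=1..?J. ?f j) \<le> (\<Sum>j=1..?J. 2 * \<gamma>\<^sup>2 / real N + 4 * B / real N * (\<theta> j * s2 j))"
    proof (rule sum_mono)
      fix j assume "j \<in> {1..?J}"
      then have j: "j \<ge> 1" by simp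
      have p0: "\<theta> j * s2 j > 0" using \<theta>_pos[OF j] s2_pos[OF j] by simp
      have "?f j \<le> \<theta> j * s2 j * (2 / z N j + 4 * B / real N)"
        using p0 by (intro mult_left_mono v_le N j) auto
      also have "\<dots> = 2 * \<gamma>\<^sup>2 / real N + 4 * B / real N * (\<theta> j * s2 j)"
        using \<theta>_pos[OF j] s2_pos[OF j] \<gamma> N by (simp add: z field_simps power2_eq_square)
      finally show "?f j \<le> 2 * \<gamma>\<^sup>2 / real N + 4 * B / real N * (\<theta> j * s2 j)" .
    qed
    also have "\<dots> = 2 * \<gamma>\<^sup>2 * (real ?J / real N) + 4 * B / real N * (\<Sum>j=1..?J. \<theta> j * s2 j)"
      by (simp add: sum.distrib sum_distrib_left)
    also have "\<dots> \<le> 2 * \<gamma>\<^sup>2 * rate N + 4 * B / real N * D"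
    proof (intro add_mono mult_left_mono)
      show "real ?J / real N \<le> rate N"
        unfolding rate_eq(1)[OF N] using level_bounds[OF N] by (intro divide_right_mono) auto
      show "(\<Sum>j=1..?J. \<theta> j * s2 j) \<le> D"
        unfolding D_def
        by (intro finite_sum_le_infsum summable_\<theta>s2)
           (auto intro!: mult_nonneg_nonneg \<theta>_nonneg s2_nonneg)
    qed (use B in auto)
    also have "4 * B / real N * D \<le> 4 * B * D * rate N"
      using mult_left_mono[OF rate_eq(3)[OF N], of "4 * B * D"] B D by simp
    finally have head: "(\<Sum>j=1..?J. ?f j) \<le> 2 * \<gamma>\<^sup>2 * rate N + 4 * B * D * rate N"
      by simp
    have sub: "{?J<..} \<subseteq> {1..}" by auto
    have ps: "(\<lambda>j. real j powr - (2 * q)) summable_on {?J<..}"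
      using ap by (intro powr_tail_sum J) auto
    have "(\<Sum>\<^sub>\<infinity>j\<in>{?J<..}. ?f j) \<le> (\<Sum>\<^sub>\<infinity>j\<in>{?J<..}. C\<^sub>\<theta> * C\<^sub>\<sigma> * real j powr - (2 * q))"
    proof (rule infsum_mono)
      show "?f summable_on {?J<..}"
        by (rule summable_on_subset_banach[OF summable_variance[OF N] sub])
      show "(\<lambda>j. C\<^sub>\<theta> * C\<^sub>\<sigma> * real j powr - (2 * q)) summable_on {?J<..}"
        by (intro summable_on_cmult_right ps)
      fix j assume "j \<in> {?J<..}"
      then have j: "j \<ge> 1" by simp
      have "?f j \<le> \<theta> j * s2 j"
        using \<theta>_pos[OF j] s2_pos[OF j] v01[OF N j] by (intro mult_left_le) auto
      also have "\<dots> \<le> C\<^sub>\<theta> * C\<^sub>\<sigma> * real j powr - (2 * q)" by (rule \<theta>s2_bounds[OF j])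
      finally show "?f j \<le> C\<^sub>\<theta> * C\<^sub>\<sigma> * real j powr - (2 * q)" .
    qed
    also have "\<dots> = C\<^sub>\<theta> * C\<^sub>\<sigma> * (\<Sum>\<^sub>\<infinity>j\<in>{?J<..}. real j powr - (2 * q))"
      using ps by (intro infsum_cmult_right) auto
    also have "\<dots> \<le> C\<^sub>\<theta> * C\<^sub>\<sigma> * (real ?J powr (1 - 2 * q) / (2 * q - 1))"
      using pos ap by (intro mult_left_mono powr_tail_sum J) auto
    also have "\<dots> \<le> C\<^sub>\<theta> * C\<^sub>\<sigma> * ((real N powr (1 / (2 * q)) / 2) powr (1 - 2 * q) / (2 * q - 1))"
      using pos ap level_bounds[OF N] N by (intro mult_left_mono divide_right_mono powr_mono2') auto
    also have "\<dots> = T * rate N"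
      unfolding rate_eq(2)[OF N] T_def
      by (simp add: powr_divide powr_diff field_simps)
    finally have tail: "(\<Sum>\<^sub>\<infinity>j\<in>{?J<..}. ?f j) \<le> T * rate N" .
    show "(\<Sum>\<^sub>\<infinity>j\<in>{1..}. ?f j) \<le> (2 * \<gamma>\<^sup>2 + 4 * B * D + T) * rate N"
      using head tail unfolding infsum_split_at[OF summable_variance[OF N], of ?J]
      by (simp add: algebra_simps)
  qed
qed

text \<open>A bound for the bias off the exceptional event: half the mean replaces the random
  signal-to-noise ratio, and the square in the denominator is dropped.\<close>

definition smooth_bias :: "nat \<Rightarrow> real" where
  "smooth_bias N = (\<Sum>\<^sub>\<infinity>j\<in>{1..}. \<theta> j * (l j)\<^sup>2 / (1 + z N j / 2))"

lemma summable_smooth_bias: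
  assumes "N \<ge> 1"
  shows "(\<lambda>j. \<theta> j * (l j)\<^sup>2 / (1 + z N j / 2)) summable_on {1..}"
proof (rule summable_on_comparison_test[OF summable_\<theta>l])
  fix j :: nat assume "j \<in> {1..}"
  then have j: "j \<ge> 1" by simp
  have t: "\<theta> j * (l j)\<^sup>2 \<ge> 0" "1 + z N j / 2 \<ge> 1"
    using \<theta>_pos[OF j] z_pos[OF assms j] by auto
  then show "\<theta> j * (l j)\<^sup>2 / (1 + z N j / 2) \<le> \<theta> j * (l j)\<^sup>2"
    by (smt (verit, best) divide_le_eq_1 divide_right_mono frac_le div_by_1)
  show "0 \<le> \<theta> j * (l j)\<^sup>2 / (1 + z N j / 2)"
    using t by (intro divide_nonneg_pos) auto
qed

lemma bias_le:
  assumes N: "N \<ge> 1"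
  shows "(\<Sum>\<^sub>\<infinity>j\<in>{1..}. \<theta> j * (l j)\<^sup>2 * b N j) \<le>
    smooth_bias N + 4 * B * (\<Sum>\<^sub>\<infinity>j\<in>{1..}. \<theta> j * (l j)\<^sup>2) * rate N"
proof -
  have E: "(\<Sum>\<^sub>\<infinity>j\<in>{1..}. \<theta> j * (l j)\<^sup>2) \<ge> 0"
    by (intro infsum_nonneg mult_nonneg_nonneg) (auto intro!: \<theta>_nonneg)
  have s: "(\<lambda>j. 4 * B / real N * (\<theta> j * (l j)\<^sup>2)) summable_on {1..}"
    by (intro summable_on_cmult_right summable_\<theta>l)
  have "(\<Sum>\<^sub>\<infinity>j\<in>{1..}. \<theta> j * (l j)\<^sup>2 * b N j) \<le>
    (\<Sum>\<^sub>\<infinity>j\<in>{1..}. \<theta> j * (l j)\<^sup>2 / (1 + z N j / 2) + 4 * B / real N * (\<theta> j * (l j)\<^sup>2))"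
  proof (intro infsum_mono summable_bias N summable_on_add summable_smooth_bias s)
    fix j :: nat assume "j \<in> {1..}"
    then have j: "j \<ge> 1" by simp
    have "\<theta> j * (l j)\<^sup>2 * b N j \<le> \<theta> j * (l j)\<^sup>2 * (1 / (1 + z N j / 2) + 4 * B / real N)"
      using \<theta>_pos[OF j] by (intro mult_left_mono b_le N j) auto
    also have "\<dots> = \<theta> j * (l j)\<^sup>2 / (1 + z N j / 2) + 4 * B / real N * (\<theta> j * (l j)\<^sup>2)"
      by (simp add: distrib_left)
    finally show "\<theta> j * (l j)\<^sup>2 * b N j \<le> \<theta> j * (l j)\<^sup>2 / (1 + z N j / 2) + 4 * B / real N * (\<theta> j * (l j)\<^sup>2)" .
  qed
  also have "\<dots> = smooth_bias N + 4 * B / real N * (\<Sum>\<^sub>\<infinity>j\<in>{1..}. \<theta> j * (l j)\<^sup>2)"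
    unfolding smooth_bias_def
    by (subst infsum_add[OF summable_smooth_bias[OF N] s])
       (simp only: infsum_cmult_right[OF summable_\<theta>l])
  also have "4 * B / real N * (\<Sum>\<^sub>\<infinity>j\<in>{1..}. \<theta> j * (l j)\<^sup>2) \<le> 4 * B * (\<Sum>\<^sub>\<infinity>j\<in>{1..}. \<theta> j * (l j)\<^sup>2) * rate N"
    using mult_left_mono[OF rate_eq(3)[OF N], of "4 * B * (\<Sum>\<^sub>\<infinity>j\<in>{1..}. \<theta> j * (l j)\<^sup>2)"] B E by simp
  finally show ?thesis by simp
qed

text \<open>Here \<open>p \<le> s\<close>, so the truth is smoother than draws from the prior, and cancelling \<open>\<theta>\<close> in
  \<open>\<theta> j / z N j\<close> leaves a bias of order at most \<open>1 / N\<close>, which does not exceed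
  \<open>rate N\<close>.\<close>

lemma smooth_bias_le:
  assumes "q \<le> \<alpha> + s"
  obtains K where "K \<ge> 0" "\<And>N. N \<ge> 1 \<Longrightarrow> smooth_bias N \<le> K * rate N"
proof -
  define W where "W = (\<Sum>\<^sub>\<infinity>j\<in>{1..}. real j powr (2 * s) * (l j)\<^sup>2)"
  have W: "W \<ge> 0" unfolding W_def by (intro infsum_nonneg) auto
  show thesis
  proof (rule that[of "2 * \<gamma>\<^sup>2 / c\<^sub>\<sigma> * W"])
    show "0 \<le> 2 * \<gamma>\<^sup>2 / c\<^sub>\<sigma> * W" using pos W by simp
    fix N :: nat assume N: "N \<ge> 1"
    let ?k = "2 * \<gamma>\<^sup>2 / c\<^sub>\<sigma> / real N"
    have "smooth_bias N \<le> (\<Sum>\<^sub>\<infinity>j\<in>{1..}. ?k * (real j powr (2 * s) * (l j)\<^sup>2))"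
      unfolding smooth_bias_def
    proof (intro infsum_mono summable_smooth_bias N summable_on_cmult_right l)
      fix j :: nat assume "j \<in> {1..}"
      then have j: "j \<ge> 1" by simp
      note zp = z_pos[OF N j] and tp = \<theta>_pos[OF j] and sp = s2_pos[OF j]
      have "\<theta> j * (l j)\<^sup>2 / (1 + z N j / 2) \<le> \<theta> j * (l j)\<^sup>2 / (z N j / 2)"
        using zp tp by (intro divide_left_mono) auto
      also have "\<dots> = 2 * \<gamma>\<^sup>2 / real N * (l j)\<^sup>2 * (1 / s2 j)"
        using tp sp \<gamma> N by (simp add: z field_simps)
      also have "\<dots> \<le> 2 * \<gamma>\<^sup>2 / real N * (l j)\<^sup>2 * (real j powr (2 * s) / c\<^sub>\<sigma>)"
      proof (rule mult_left_mono)
        have "1 / s2 j \<le> 1 / (c\<^sub>\<sigma> * real j powr (- 2 * p))"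
          using s2(1)[OF j] pos j sp by (intro divide_left_mono mult_pos_pos) auto
        also have "\<dots> = real j powr (2 * p) / c\<^sub>\<sigma>"
          by (simp add: powr_minus field_simps)
        also have "\<dots> \<le> real j powr (2 * s) / c\<^sub>\<sigma>"
          using pos assms j by (intro divide_right_mono powr_mono) auto
        finally show "1 / s2 j \<le> real j powr (2 * s) / c\<^sub>\<sigma>" .
      qed simp
      also have "\<dots> = ?k * (real j powr (2 * s) * (l j)\<^sup>2)" by (simp add: mult_ac)
      finally show "\<theta> j * (l j)\<^sup>2 / (1 + z N j / 2) \<le> ?k * (real j powr (2 * s) * (l j)\<^sup>2)" .
    qed
    also have "\<dots> = 2 * \<gamma>\<^sup>2 / c\<^sub>\<sigma> * W * (1 / real N)"
      unfolding W_def infsum_cmult_right[OF l] by simp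
    also have "\<dots> \<le> 2 * \<gamma>\<^sup>2 / c\<^sub>\<sigma> * W * rate N"
      using W pos by (intro mult_left_mono rate_eq(3) N) auto
    finally show "smooth_bias N \<le> 2 * \<gamma>\<^sup>2 / c\<^sub>\<sigma> * W * rate N" .
  qed
qed

text \<open>Otherwise the rescaled terms of the bias are dominated by the terms of the Sobolev norm and
  tend to zero one by one, so Tannery's theorem gives a little-o.\<close>

lemma smooth_bias_smallo:
  assumes "\<alpha> + s < q"
  shows "smooth_bias \<in> o(\<lambda>N. real N powr (- ((\<alpha> + s) / q)))"
proof -
  define \<kappa> where "\<kappa> = (\<alpha> + s) / q"
  have \<kappa>: "\<kappa> > 0" "\<kappa> < 1" using assms as ap by (auto simp: \<kappa>_def)
  have \<kappa>q: "\<kappa> * q = \<alpha> + s" using ap by (simp add: \<kappa>_def)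
  define k where "k = c\<^sub>\<theta> * c\<^sub>\<sigma> / \<gamma>\<^sup>2"
  have k: "k > 0" using pos \<gamma> by (simp add: k_def)
  define t where "t j N = real N powr \<kappa> * (\<theta> j * (l j)\<^sup>2 / (1 + z N j / 2))" for j N
  define K where "K = C\<^sub>\<theta> * max 1 (2 / k)"
  have K: "K > 0" using pos by (simp add: K_def)
  have dom: "t j N \<le> K * (real j powr (2 * s) * (l j)\<^sup>2)" if N: "N \<ge> 1" and j: "j \<ge> 1" for j N
  proof -
    \<comment> \<open>in terms of \<open>y\<close>, which is of the order of \<open>z N j\<close>, the rescaling factor becomes
      \<open>y powr \<kappa>\<close> times the weight that turns \<open>\<theta> j\<close> into the Sobolev weight\<close>
    define y where "y = real N * real j powr (- (2 * q))"
    have y: "y > 0" using N j by (simp add: y_def)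
    have zy: "k * y \<le> z N j"
      using mult_right_mono[OF \<theta>s2_bounds(1)[OF j], of "real N / \<gamma>\<^sup>2"] by (simp add: z k_def y_def mult_ac)
    have y\<kappa>: "real N powr \<kappa> = y powr \<kappa> * real j powr (2 * (\<alpha> + s))"
    proof -
      have "y powr \<kappa> * real j powr (2 * (\<alpha> + s)) =
        real N powr \<kappa> * (real j powr (- (2 * q) * \<kappa>) * real j powr (2 * (\<alpha> + s)))"
        by (simp add: y_def powr_mult powr_powr)
      also have "- (2 * q) * \<kappa> = - (2 * (\<alpha> + s))"
        using \<kappa>q by algebra
      also have "real j powr (- (2 * (\<alpha> + s))) * real j powr (2 * (\<alpha> + s)) = 1"
        using j by (subst powr_add[symmetric]) auto
      finally show ?thesis by simp
    qed
    have "y powr \<kappa> \<le> 1 + y"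
    proof (cases "y \<le> 1")
      case True
      then have "y powr \<kappa> \<le> 1" using y \<kappa> by (intro powr_le1) auto
      then show ?thesis using y by simp
    next
      case False
      then have "y powr \<kappa> \<le> y powr 1" using \<kappa> by (intro powr_mono) auto
      then show ?thesis using y by simp
    qed
    also have "\<dots> \<le> max 1 (2 / k) * (1 + k * y / 2)"
    proof -
      have "y = (2 / k) * (k * y / 2)" using k by simp
      also have "\<dots> \<le> max 1 (2 / k) * (k * y / 2)" using k y by (intro mult_right_mono) auto
      finally show ?thesis by (simp add: distrib_left add_mono)
    qed
    also have "\<dots> \<le> max 1 (2 / k) * (1 + z N j / 2)"
      using zy by (intro mult_left_mono) auto
    finally have y1: "y powr \<kappa> / (1 + z N j / 2) \<le> max 1 (2 / k)"
      using z_pos[OF N j] by (subst pos_divide_le_eq) auto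
    have "t j N = (y powr \<kappa> / (1 + z N j / 2)) * (\<theta> j * (real j powr (2 * (\<alpha> + s)) * (l j)\<^sup>2))"
      by (simp add: t_def y\<kappa> mult_ac)
    also have "\<dots> \<le> max 1 (2 / k) * (C\<^sub>\<theta> * real j powr (- 2 * \<alpha>) * (real j powr (2 * (\<alpha> + s)) * (l j)\<^sup>2))"
      using \<theta>_pos[OF j] pos by (intro mult_mono y1 \<theta>(2) j) auto
    also have "\<dots> = K * ((real j powr (- 2 * \<alpha>) * real j powr (2 * (\<alpha> + s))) * (l j)\<^sup>2)"
      by (simp add: K_def mult_ac)
    also have "real j powr (- 2 * \<alpha>) * real j powr (2 * (\<alpha> + s)) = real j powr (2 * s)"
      by (simp add: powr_add[symmetric] algebra_simps)
    finally show ?thesis .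
  qed
  have t0: "t j N \<ge> 0" if "N \<ge> 1" "j \<ge> 1" for j N
    using \<theta>_pos[OF that(2)] z_pos[OF that] by (simp add: t_def)
  have dom': "norm (t (Suc i) N) \<le> K * (real (Suc i) powr (2 * s) * (l (Suc i))\<^sup>2)" if "Suc 0 \<le> N" for i N
    using dom[of N "Suc i"] t0[of N "Suc i"] that by simp
  have lim: "(\<lambda>N. t j N) \<longlonglongrightarrow> 0" if j: "j \<ge> 1" for j
  proof (rule Lim_null_comparison)
    define C where "C = 2 * (l j)\<^sup>2 * \<gamma>\<^sup>2 / s2 j"
    show "\<forall>\<^sub>F N in sequentially. norm (t j N) \<le> C * real N powr (- (1 - \<kappa>))"
      using eventually_ge_at_top[of 1]
    proof eventually_elim
      case (elim N)
      note zp = z_pos[OF elim j]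
      have "t j N \<le> real N powr \<kappa> * (\<theta> j * (l j)\<^sup>2 / (z N j / 2))"
        unfolding t_def using zp \<theta>_pos[OF j] by (intro mult_left_mono divide_left_mono) auto
      also have "\<dots> = C * (real N powr \<kappa> / real N)"
        using \<theta>_pos[OF j] s2_pos[OF j] \<gamma> elim by (simp add: z C_def field_simps)
      also have "real N powr \<kappa> / real N = real N powr (- (1 - \<kappa>))"
        using elim by (simp add: powr_diff)
      finally show ?case using t0[OF elim j] by simp
    qed
    have "(\<lambda>N. real N powr (- (1 - \<kappa>))) \<longlonglongrightarrow> 0"
      using \<kappa> by (intro tendsto_neg_powr filterlim_real_sequentially) auto
    then show "(\<lambda>N. C * real N powr (- (1 - \<kappa>))) \<longlonglongrightarrow> 0"
      by (rule tendsto_mult_right_zero)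
  qed
  have "(\<lambda>N. \<Sum>i. t (Suc i) N) \<longlonglongrightarrow> (\<Sum>i. 0)"
  proof (rule tannerys_theorem[THEN conjunct2, THEN conjunct2])
    show "(\<lambda>N. t (Suc i) N) \<longlonglongrightarrow> 0" for i by (rule lim) simp
    show "\<forall>\<^sub>F (i, N) in at_top \<times>\<^sub>F sequentially.
        norm (t (Suc i) N) \<le> K * (real (Suc i) powr (2 * s) * (l (Suc i))\<^sup>2)"
      unfolding eventually_prod_filter
      by (rule exI[of _ "\<lambda>_. True"], rule exI[of _ "\<lambda>N. N \<ge> 1"])
         (simp add: eventually_ge_at_top dom' del: of_nat_Suc real_norm_def)
    have "(\<lambda>j. K * (real j powr (2 * s) * (l j)\<^sup>2)) summable_on {1..}"
      by (intro summable_on_cmult_right l)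
    then have "(\<lambda>i. K * (real (Suc i) powr (2 * s) * (l (Suc i))\<^sup>2)) summable_on UNIV"
      by (subst summable_on_reindex_bij_betw[OF bij_betw_Suc_positive])
    then show "summable (\<lambda>i. K * (real (Suc i) powr (2 * s) * (l (Suc i))\<^sup>2))"
      by (rule summable_on_imp_summable)
  qed simp
  then have T: "(\<lambda>N. \<Sum>i. t (Suc i) N) \<longlonglongrightarrow> 0" by simp
  have eq: "(\<Sum>i. t (Suc i) N) = smooth_bias N / real N powr (- \<kappa>)" if N: "N \<ge> 1" for N
  proof -
    have st: "(\<lambda>j. t j N) summable_on {1..}"
      unfolding t_def by (intro summable_on_cmult_right summable_smooth_bias N)
    have "((\<lambda>i. t (Suc i) N) has_sum (\<Sum>\<^sub>\<infinity>j\<in>{1..}. t j N)) UNIV"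
      using st by (subst has_sum_reindex_bij_betw[OF bij_betw_Suc_positive]) simp
    then have "(\<Sum>i. t (Suc i) N) = (\<Sum>\<^sub>\<infinity>j\<in>{1..}. t j N)"
      using has_sum_imp_sums sums_unique by metis
    also have "\<dots> = real N powr \<kappa> * smooth_bias N"
      unfolding t_def smooth_bias_def
      by (rule infsum_cmult_right[OF summable_smooth_bias[OF N]])
    finally show ?thesis by (simp add: powr_minus field_simps)
  qed
  show ?thesis
    unfolding \<kappa>_def[symmetric]
  proof (rule smalloI_tendsto)
    show "(\<lambda>N. smooth_bias N / real N powr (- \<kappa>)) \<longlonglongrightarrow> 0"
      by (rule Lim_transform_eventually[OF T])
         (use eq in \<open>auto intro: eventually_mono[OF eventually_ge_at_top[of 1]]\<close>)
    show "\<forall>\<^sub>F N in sequentially. real N powr (- \<kappa>) \<noteq> 0"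
      using eventually_ge_at_top[of 1] by eventually_elim auto
  qed
qed

text \<open>Between the level and its double the signal-to-noise ratio is bounded above and below.\<close>

lemma z_bounds:
  assumes N: "N \<ge> 1" and j: "j > level N"
  shows "z N j \<le> C\<^sub>\<theta> * C\<^sub>\<sigma> / \<gamma>\<^sup>2"
    and "j \<le> 2 * level N \<Longrightarrow> c\<^sub>\<theta> * c\<^sub>\<sigma> / \<gamma>\<^sup>2 * 2 powr (- (2 * q)) \<le> z N j"
    and "j \<le> 2 * level N \<Longrightarrow> c\<^sub>\<theta> * c\<^sub>\<sigma> * 2 powr (- (2 * q)) / real N \<le> \<theta> j * s2 j"
proof -
  let ?M = "real N powr (1 / (2 * q))"
  have j1: "j \<ge> 1" using j by simp
  have M0: "?M > 0" using N by simp
  have NM: "?M powr (- (2 * q)) = 1 / real N"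
  proof -
    have q0: "2 * q \<noteq> 0" using ap by simp
    have "1 / (2 * q) * - (2 * q) = - 1"
      by (simp only: mult_minus_right times_divide_eq_left mult_1_left divide_self[OF q0])
    then show ?thesis using N unfolding powr_powr by (simp add: powr_minus_divide)
  qed
  have "?M \<le> real j" using level_bounds(3)[OF N] j by linarith
  then have "real j powr (- (2 * q)) \<le> ?M powr (- (2 * q))"
    using M0 ap by (intro powr_mono2') auto
  then have u: "real j powr (- (2 * q)) \<le> 1 / real N" unfolding NM .
  have "z N j = \<theta> j * s2 j * (real N / \<gamma>\<^sup>2)" by (simp add: z)
  also have "\<dots> \<le> C\<^sub>\<theta> * C\<^sub>\<sigma> * (1 / real N) * (real N / \<gamma>\<^sup>2)"
    using \<theta>s2_bounds(2)[OF j1] mult_left_mono[OF u, of "C\<^sub>\<theta> * C\<^sub>\<sigma>"] pos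
    by (intro mult_right_mono) auto
  finally show "z N j \<le> C\<^sub>\<theta> * C\<^sub>\<sigma> / \<gamma>\<^sup>2" using N by simp
  assume "j \<le> 2 * level N"
  then have "real j \<le> 2 * ?M" using level_bounds(2)[OF N] by linarith
  then have "(2 * ?M) powr (- (2 * q)) \<le> real j powr (- (2 * q))"
    using j1 ap by (intro powr_mono2') auto
  then have w: "2 powr (- (2 * q)) / real N \<le> real j powr (- (2 * q))"
    using M0 NM by (simp add: powr_mult)
  show low: "c\<^sub>\<theta> * c\<^sub>\<sigma> * 2 powr (- (2 * q)) / real N \<le> \<theta> j * s2 j"
    using \<theta>s2_bounds(1)[OF j1] mult_left_mono[OF w, of "c\<^sub>\<theta> * c\<^sub>\<sigma>"] pos by simp
  have "c\<^sub>\<theta> * c\<^sub>\<sigma> * 2 powr (- (2 * q)) / real N * (real N / \<gamma>\<^sup>2) \<le> \<theta> j * s2 j * (real N / \<gamma>\<^sup>2)"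
    by (intro mult_right_mono low) auto
  then show "c\<^sub>\<theta> * c\<^sub>\<sigma> / \<gamma>\<^sup>2 * 2 powr (- (2 * q)) \<le> z N j"
    using N by (simp add: z mult_ac)
qed

definition risk :: "nat \<Rightarrow> real" where
  "risk N = (\<Sum>\<^sub>\<infinity>j\<in>{1..}. \<theta> j * ((l j)\<^sup>2 * b N j + s2 j * v N j))"

lemma risk_eq:
  assumes "N \<ge> 1"
  shows "(\<lambda>j. \<theta> j * ((l j)\<^sup>2 * b N j + s2 j * v N j)) summable_on {1..}"
    and "risk N = (\<Sum>\<^sub>\<infinity>j\<in>{1..}. \<theta> j * (l j)\<^sup>2 * b N j) + (\<Sum>\<^sub>\<infinity>j\<in>{1..}. \<theta> j * s2 j * v N j)"
proof -
  have e: "\<theta> j * ((l j)\<^sup>2 * b N j + s2 j * v N j) = \<theta> j * (l j)\<^sup>2 * b N j + \<theta> j * s2 j * v N j" for j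
    by (simp add: distrib_left)
  show "(\<lambda>j. \<theta> j * ((l j)\<^sup>2 * b N j + s2 j * v N j)) summable_on {1..}"
    unfolding e by (intro summable_on_add summable_bias summable_variance assms)
  show "risk N = (\<Sum>\<^sub>\<infinity>j\<in>{1..}. \<theta> j * (l j)\<^sup>2 * b N j) + (\<Sum>\<^sub>\<infinity>j\<in>{1..}. \<theta> j * s2 j * v N j)"
    unfolding risk_def e by (intro infsum_add summable_bias summable_variance assms)
qed

lemma risk_nonneg: "N \<ge> 1 \<Longrightarrow> risk N \<ge> 0"
  unfolding risk_def using b01 v01 \<theta>_pos s2_pos
  by (intro infsum_nonneg mult_nonneg_nonneg add_nonneg_nonneg) (auto intro: less_imp_le)

lemma risk_le:
  obtains K G where "K \<ge> 0" "\<And>N. G N \<ge> 0" "G \<in> o(\<lambda>N. real N powr (- ((\<alpha> + s) / q)))"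
    "\<And>N. N \<ge> 1 \<Longrightarrow> risk N \<le> K * rate N + G N"
proof -
  obtain K1 where K1: "K1 \<ge> 0" "\<And>N. N \<ge> 1 \<Longrightarrow> (\<Sum>\<^sub>\<infinity>j\<in>{1..}. \<theta> j * s2 j * v N j) \<le> K1 * rate N"
    by (rule variance_le) blast
  define K2 where "K2 = 4 * B * (\<Sum>\<^sub>\<infinity>j\<in>{1..}. \<theta> j * (l j)\<^sup>2)"
  have "(\<Sum>\<^sub>\<infinity>j\<in>{1..}. \<theta> j * (l j)\<^sup>2) \<ge> 0"
    by (intro infsum_nonneg mult_nonneg_nonneg) (auto intro!: \<theta>_nonneg)
  then have K2: "K2 \<ge> 0" using B by (simp add: K2_def)
  have upper: "risk N \<le> (K1 + K2) * rate N + smooth_bias N" if "N \<ge> 1" for N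
    using K1(2)[OF that] bias_le[OF that] unfolding risk_eq(2)[OF that] K2_def
    by (simp add: distrib_right)
  show thesis
  proof (cases "q \<le> \<alpha> + s")
    case True
    then obtain K3 where K3: "K3 \<ge> 0" "\<And>N. N \<ge> 1 \<Longrightarrow> smooth_bias N \<le> K3 * rate N"
      by (rule smooth_bias_le) blast
    show thesis
    proof (rule that[of "K1 + K2 + K3" "\<lambda>_. 0"])
      show "risk N \<le> (K1 + K2 + K3) * rate N + 0" if "N \<ge> 1" for N
        using upper[OF that] K3(2)[OF that] by (simp add: distrib_right)
    qed (use K1 K2 K3 in auto)
  next
    case False
    show thesis
    proof (rule that[of "K1 + K2" "\<lambda>N. \<bar>smooth_bias N\<bar>"])
      show "risk N \<le> (K1 + K2) * rate N + \<bar>smooth_bias N\<bar>" if "N \<ge> 1" for N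
        using upper[OF that] by linarith
      show "(\<lambda>N. \<bar>smooth_bias N\<bar>) \<in> o(\<lambda>N. real N powr (- ((\<alpha> + s) / q)))"
        using smooth_bias_smallo False by (simp add: landau_o.small.abs_in_iff)
    qed (use K1 K2 in auto)
  qed
qed

text \<open>Just above the level the signal-to-noise ratio is of order one, so each of the about
  \<open>level N\<close> eigenvalues there keeps a fixed fraction of its prior variance.  The bias above the
  level is never damped by more than a constant factor.\<close>

lemma risk_ge:
  obtains c where "c > 0"
    "\<And>N. N \<ge> 1 \<Longrightarrow> real N \<ge> 8 * B \<Longrightarrow>
       c * (rate N + (\<Sum>\<^sub>\<infinity>j\<in>{level N<..}. real j powr (- 2 * \<alpha>) * (l j)\<^sup>2)) \<le> risk N"
proof -
  define k2 where "k2 = C\<^sub>\<theta> * C\<^sub>\<sigma> / \<gamma>\<^sup>2"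
  define k1 where "k1 = c\<^sub>\<theta> * c\<^sub>\<sigma> / \<gamma>\<^sup>2 * 2 powr (- (2 * q))"
  define k0 where "k0 = c\<^sub>\<theta> * c\<^sub>\<sigma> * 2 powr (- (2 * q))"
  have kp: "k2 > 0" "k1 > 0" "k0 > 0"
    using pos \<gamma> by (auto simp: k2_def k1_def k0_def)
  define \<beta> where "\<beta> = 1 / 2 * (1 / (1 + 3 * k2 / 2)\<^sup>2)"
  define \<delta> where "\<delta> = 1 / 2 * (k1 / 2 / (1 + 3 * k2 / 2)\<^sup>2)"
  have bp: "\<beta> > 0" "\<delta> > 0" using kp by (auto simp: \<beta>_def \<delta>_def intro!: divide_pos_pos zero_less_power)
  define c where "c = min (\<beta> * c\<^sub>\<theta>) (k0 * \<delta> / 2)"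
  have c: "c > 0" "c \<le> \<beta> * c\<^sub>\<theta>" "c \<le> k0 * \<delta> / 2" using bp kp pos by (auto simp: c_def)
  show thesis
  proof (rule that[OF c(1)])
    fix N :: nat assume N: "N \<ge> 1" and N8: "real N \<ge> 8 * B"
    let ?J = "level N" and ?T = "\<Sum>\<^sub>\<infinity>j\<in>{level N<..}. real j powr (- 2 * \<alpha>) * (l j)\<^sup>2"
    have sub: "{?J<..} \<subseteq> {1..}" by auto
    have T0: "?T \<ge> 0" by (intro infsum_nonneg) auto
    have sT: "(\<lambda>j. real j powr (- 2 * \<alpha>) * (l j)\<^sup>2) summable_on {?J<..}"
    proof (rule summable_on_comparison_test)
      show "(\<lambda>j. (1 / c\<^sub>\<theta>) * (\<theta> j * (l j)\<^sup>2)) summable_on {?J<..}"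
        by (intro summable_on_cmult_right summable_on_subset_banach[OF summable_\<theta>l sub])
      fix j assume "j \<in> {?J<..}"
      then have j: "j \<ge> 1" by simp
      have "real j powr (- 2 * \<alpha>) \<le> (1 / c\<^sub>\<theta>) * \<theta> j"
        using \<theta>(1)[OF j] pos by (simp add: field_simps)
      then show "real j powr (- 2 * \<alpha>) * (l j)\<^sup>2 \<le> (1 / c\<^sub>\<theta>) * (\<theta> j * (l j)\<^sup>2)"
        by (metis mult.assoc mult_right_mono zero_le_power2)
    qed simp
    have "\<beta> * c\<^sub>\<theta> * ?T = (\<Sum>\<^sub>\<infinity>j\<in>{?J<..}. \<beta> * c\<^sub>\<theta> * (real j powr (- 2 * \<alpha>) * (l j)\<^sup>2))"
      using sT by (intro infsum_cmult_right[symmetric]) auto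
    also have "\<dots> \<le> (\<Sum>\<^sub>\<infinity>j\<in>{1..}. \<theta> j * (l j)\<^sup>2 * b N j)"
    proof (rule infsum_mono_neutral)
      show "(\<lambda>j. \<beta> * c\<^sub>\<theta> * (real j powr (- 2 * \<alpha>) * (l j)\<^sup>2)) summable_on {?J<..}"
        by (intro summable_on_cmult_right sT)
      fix j assume "j \<in> {?J<..} \<inter> {1..}"
      then have j: "j > ?J" "j \<ge> 1" by auto
      have zp: "0 \<le> z N j" using z_pos[OF N j(2)] by simp
      have "\<beta> \<le> 1 / 2 * (1 / (1 + 3 * z N j / 2)\<^sup>2)"
        unfolding \<beta>_def using zp z_bounds(1)[OF N j(1), folded k2_def] kp
        by (intro mult_left_mono divide_left_mono power_mono mult_pos_pos zero_less_power) auto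
      also have "\<dots> \<le> b N j" by (rule b_ge[OF N j(2) N8])
      finally have "(c\<^sub>\<theta> * real j powr (- 2 * \<alpha>) * (l j)\<^sup>2) * \<beta> \<le> (\<theta> j * (l j)\<^sup>2) * b N j"
        using bp \<theta>_pos[OF j(2)] by (intro mult_mono mult_right_mono \<theta>(1) j) auto
      then show "\<beta> * c\<^sub>\<theta> * (real j powr (- 2 * \<alpha>) * (l j)\<^sup>2) \<le> \<theta> j * (l j)\<^sup>2 * b N j"
        by (simp add: mult_ac)
    qed (use sub in \<open>auto intro!: summable_bias[OF N, simplified] mult_nonneg_nonneg \<theta>_nonneg b01 N\<close>)
    finally have bias: "\<beta> * c\<^sub>\<theta> * ?T \<le> (\<Sum>\<^sub>\<infinity>j\<in>{1..}. \<theta> j * (l j)\<^sup>2 * b N j)" .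
    have "k0 * \<delta> / 2 * rate N = (real N powr (1 / (2 * q)) / 2) * (k0 / real N * \<delta>)"
      unfolding rate_eq(1)[OF N] by simp
    also have "\<dots> \<le> real ?J * (k0 / real N * \<delta>)"
      using level_bounds(4)[OF N] kp bp by (intro mult_right_mono) auto
    also have "\<dots> = (\<Sum>j\<in>{?J<..2 * ?J}. k0 / real N * \<delta>)"
      by simp
    also have "\<dots> \<le> (\<Sum>j\<in>{?J<..2 * ?J}. \<theta> j * s2 j * v N j)"
    proof (rule sum_mono)
      fix j assume "j \<in> {?J<..2 * ?J}"
      then have j: "j > ?J" "j \<le> 2 * ?J" "j \<ge> 1" by auto
      have zp: "0 \<le> z N j" using z_pos[OF N j(3)] by simp
      have "\<delta> \<le> 1 / 2 * (z N j / 2 / (1 + 3 * z N j / 2)\<^sup>2)"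
        unfolding \<delta>_def
        using zp z_bounds(1)[OF N j(1), folded k2_def] z_bounds(2)[OF N j(1,2), folded k1_def] kp
        by (intro mult_left_mono frac_le power_mono zero_less_power) auto
      also have "\<dots> \<le> v N j" by (rule v_ge[OF N j(3) N8])
      finally show "k0 / real N * \<delta> \<le> \<theta> j * s2 j * v N j"
        using z_bounds(3)[OF N j(1,2)] bp \<theta>_pos[OF j(3)] s2_pos[OF j(3)]
        by (intro mult_mono) (auto simp: k0_def)
    qed
    also have "\<dots> \<le> (\<Sum>\<^sub>\<infinity>j\<in>{1..}. \<theta> j * s2 j * v N j)"
      by (intro finite_sum_le_infsum summable_variance N)
         (auto intro!: mult_nonneg_nonneg \<theta>_nonneg s2_nonneg v01 N)
    finally have var: "k0 * \<delta> / 2 * rate N \<le> (\<Sum>\<^sub>\<infinity>j\<in>{1..}. \<theta> j * s2 j * v N j)" .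
    have "c * ?T \<le> \<beta> * c\<^sub>\<theta> * ?T" "c * rate N \<le> k0 * \<delta> / 2 * rate N"
      by (rule mult_right_mono[OF c(2) T0], rule mult_right_mono[OF c(3)]) (simp add: rate_def)
    then show "c * (rate N + ?T) \<le> risk N"
      using bias var unfolding risk_eq(2)[OF N] by (simp add: distrib_left)
  qed
qed

end

section \<open>Convergence rates of the posterior mean\<close>

lemma bigo_imp_bound_everywhere:
  fixes f g :: "nat \<Rightarrow> real"
  assumes "f \<in> O(g)" and g: "\<And>j. j \<ge> 1 \<Longrightarrow> g j > 0"
  obtains C where "C > 0" "\<And>j. j \<ge> 1 \<Longrightarrow> f j \<le> C * g j"
proof -
  obtain c where c: "c > 0" "\<forall>\<^sub>F j in sequentially. norm (f j) \<le> c * norm (g j)"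
    using assms(1) by (elim landau_o.bigE)
  then obtain n where n: "\<And>j. j \<ge> n \<Longrightarrow> \<bar>f j\<bar> \<le> c * \<bar>g j\<bar>"
    by (auto simp: eventually_sequentially)
  \<comment> \<open>the finitely many indices below \<open>n\<close> are absorbed into the constant\<close>
  define S where "S = (\<Sum>j=1..n. \<bar>f j\<bar> / g j)"
  have S: "S \<ge> 0" unfolding S_def by (intro sum_nonneg divide_nonneg_pos) (auto intro: g)
  show thesis
  proof (rule that[of "c + S"])
    show "c + S > 0" using c S by simp
    fix j :: nat assume j: "j \<ge> 1"
    show "f j \<le> (c + S) * g j"
    proof (cases "j \<ge> n")
      case True
      have "f j \<le> c * g j" using n[OF True] g[OF j] by simp
      also have "\<dots> \<le> (c + S) * g j" using S g[OF j] by (intro mult_right_mono) auto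
      finally show ?thesis .
    next
      case False
      have "\<bar>f j\<bar> / g j \<le> S"
        unfolding S_def using j False
        by (intro member_le_sum) (auto intro!: divide_nonneg_pos g)
      then have "\<bar>f j\<bar> / g j \<le> c + S" using c by simp
      then show ?thesis using g[OF j] by (simp add: pos_divide_le_eq)
    qed
  qed
qed

lemma bigtheta_imp_bounds_everywhere:
  fixes f g :: "nat \<Rightarrow> real"
  assumes "f \<in> \<Theta>(g)" and f: "\<And>j. j \<ge> 1 \<Longrightarrow> f j > 0" and g: "\<And>j. j \<ge> 1 \<Longrightarrow> g j > 0"
  obtains c C where "c > 0" "C > 0" "\<And>j. j \<ge> 1 \<Longrightarrow> c * g j \<le> f j" "\<And>j. j \<ge> 1 \<Longrightarrow> f j \<le> C * g j"
proof -
  obtain C where C: "C > 0" "\<And>j. j \<ge> 1 \<Longrightarrow> f j \<le> C * g j"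
    using bigo_imp_bound_everywhere[of f g, OF bigthetaD1[OF assms(1)] g] by blast
  have "g \<in> O(f)"
    using assms(1) by (intro bigthetaD1) (simp only: bigtheta_sym)
  then obtain D where D: "D > 0" "\<And>j. j \<ge> 1 \<Longrightarrow> g j \<le> D * f j"
    using bigo_imp_bound_everywhere[of g f, OF _ f] by blast
  show thesis
    by (rule that[of "1 / D" C]) (use C D in \<open>auto simp: field_simps\<close>)
qed

theorem corollary3p10:
  fixes \<phi> :: "nat \<Rightarrow> 'a::{real_inner, banach, second_countable_topology}"
    and \<nu> :: "'a measure"
    and l \<sigma> :: "nat \<Rightarrow> real"
    and \<gamma> s p \<alpha> :: real
    and J :: "nat \<Rightarrow> nat"
  assumes "orthonormal_basis \<phi>"
    and "training_measure \<phi> \<nu>"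
    and "\<gamma> > 0"
    and "\<forall>j\<ge>1. (\<sigma> j)\<^sup>2 > 0"
    and "\<alpha> > 1 / 2" and "\<alpha> + s > 0" and "\<alpha> + (p - 1 / 2) > 0"
    and "l \<in> sobolev_seq s"
    and "(\<lambda>j. (\<sigma> j)\<^sup>2) \<in> \<Theta>(\<lambda>j. real j powr (- 2 * p))"
    and "(\<lambda>j. \<phi> j \<bullet> cov_op \<nu> (\<phi> j)) \<in> \<Theta>(\<lambda>j. real j powr (- 2 * \<alpha>))"
    and "moment_assumption \<phi> \<nu>"
    and "\<forall>N. J N = nat \<lfloor>real N powr (1 / (2 * (\<alpha> + p)))\<rfloor>"
  shows "(\<exists>f g :: nat \<Rightarrow> real.
            (\<forall>N. f N \<ge> 0 \<and> g N \<ge> 0) \<and>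
            f \<in> O(\<lambda>N. real N powr (- ((\<alpha> + p - 1 / 2) / (\<alpha> + p)))) \<and>
            g \<in> o(\<lambda>N. real N powr (- ((\<alpha> + s) / (\<alpha> + p)))) \<and>
            (\<forall>\<^sub>F N in sequentially.
               expected_excess_risk \<phi> \<nu> \<gamma> l \<sigma> N = ennreal (f N + g N)))
       \<and> (\<forall>\<tau> :: nat \<Rightarrow> real.
            (\<forall>n\<ge>1. \<tau> n > 0) \<and> \<tau> \<longlonglongrightarrow> 0 \<and>
            filterlim (\<lambda>n. real n * \<tau> n) at_top sequentially \<longrightarrow>
            (\<lambda>N. enn2real (expected_excess_risk \<phi> \<nu> \<gamma> l \<sigma> N)) \<in>
              \<Omega>(\<lambda>N. \<tau> N * real N powr (- ((\<alpha> + p - 1 / 2) / (\<alpha> + p)))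
                     + (\<Sum>\<^sub>\<infinity>j\<in>{J N<..}. real j powr (- 2 * \<alpha>) * (l j)\<^sup>2)))"
proof -
  have on: "\<forall>i\<ge>1. \<forall>j\<ge>1. \<phi> i \<bullet> \<phi> j = (if i = j then 1 else 0)"
    using assms(1) by (simp add: orthonormal_basis_def)
  have nu: "prob_space \<nu>" and bor: "sets \<nu> = sets borel" and int: "integrable \<nu> (\<lambda>x. (norm x)\<^sup>2)"
    and pd: "\<And>h. h \<noteq> 0 \<Longrightarrow> h \<bullet> cov_op \<nu> h > 0"
    using assms(2) by (auto simp: training_measure_def)
  define \<theta> where "\<theta> j = \<phi> j \<bullet> cov_op \<nu> (\<phi> j)" for j
  have \<theta>_pos: "\<theta> j > 0" if "j \<ge> 1" for j
  proof -
    have "\<phi> j \<bullet> \<phi> j = 1" using on that by simp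
    then have "\<phi> j \<noteq> 0" by auto
    then show ?thesis unfolding \<theta>_def by (rule pd)
  qed
  have \<theta>_nonneg: "\<phi> j \<bullet> cov_op \<nu> (\<phi> j) \<ge> 0" for j
    unfolding inner_cov_op[OF bor int] by (intro Bochner_Integration.integral_nonneg) auto
  obtain B where B: "B > 0" "\<And>h. integrable \<nu> (\<lambda>x. (h \<bullet> x) ^ 4)"
    "\<And>h. (\<integral>x. (h \<bullet> x) ^ 4 \<partial>\<nu>) \<le> B * (h \<bullet> cov_op \<nu> h)\<^sup>2"
    using assms(11) unfolding moment_assumption_def by (elim conjE uniform_fourth_moment[OF nu bor int]) blast
  obtain c\<^sub>\<theta> C\<^sub>\<theta> where c\<theta>: "c\<^sub>\<theta> > 0" "C\<^sub>\<theta> > 0" "\<And>j. j \<ge> 1 \<Longrightarrow> c\<^sub>\<theta> * real j powr (- 2 * \<alpha>) \<le> \<theta> j"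
    "\<And>j. j \<ge> 1 \<Longrightarrow> \<theta> j \<le> C\<^sub>\<theta> * real j powr (- 2 * \<alpha>)"
    using assms(10) \<theta>_pos unfolding \<theta>_def[symmetric] by (elim bigtheta_imp_bounds_everywhere) auto
  obtain c\<^sub>\<sigma> C\<^sub>\<sigma> where c\<sigma>: "c\<^sub>\<sigma> > 0" "C\<^sub>\<sigma> > 0" "\<And>j. j \<ge> 1 \<Longrightarrow> c\<^sub>\<sigma> * real j powr (- 2 * p) \<le> (\<sigma> j)\<^sup>2"
    "\<And>j. j \<ge> 1 \<Longrightarrow> (\<sigma> j)\<^sup>2 \<le> C\<^sub>\<sigma> * real j powr (- 2 * p)"
    using assms(9) assms(4) by (elim bigtheta_imp_bounds_everywhere) auto
  define b where "b N j = shrinkage \<nu> (\<phi> j) ((\<sigma> j)\<^sup>2 / \<gamma>\<^sup>2) N" for N j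
  define v where "v N j = noise_gain \<nu> (\<phi> j) ((\<sigma> j)\<^sup>2 / \<gamma>\<^sup>2) N" for N j
  define z where "z N j = (\<sigma> j)\<^sup>2 / \<gamma>\<^sup>2 * real N * \<theta> j" for N j
  have a: "(\<sigma> j)\<^sup>2 / \<gamma>\<^sup>2 > 0" if "j \<ge> 1" for j
    using assms(3,4) that by simp
  interpret R: balanced_risk \<theta> "\<lambda>j. (\<sigma> j)\<^sup>2" l b v z \<gamma> B \<alpha> p s c\<^sub>\<theta> C\<^sub>\<theta> c\<^sub>\<sigma> C\<^sub>\<sigma>
  proof
    show "(\<lambda>j. real j powr (2 * s) * (l j)\<^sup>2) summable_on {1..}"
      using assms(8) by (simp add: sobolev_seq_def)
    fix N j :: nat assume Nj: "N \<ge> 1" "j \<ge> 1"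
    note A = nu bor int B(2) B(3)[of "\<phi> j", folded \<theta>_def] \<theta>_def \<theta>_pos[OF Nj(2)] Nj(1) a[OF Nj(2)]
    show "0 \<le> b N j" "b N j \<le> 1" "b N j \<le> 1 / (1 + z N j / 2) + 4 * B / real N"
      unfolding b_def z_def using shrinkage_nonneg[OF A] shrinkage_le_1[OF A] shrinkage_le[OF A] by simp_all
    show "0 \<le> v N j" "v N j \<le> 1" "v N j \<le> 2 / z N j + 4 * B / real N"
      unfolding v_def z_def using noise_gain_nonneg[OF A] noise_gain_le_1[OF A] noise_gain_le[OF A] by simp_all
    assume N8: "real N \<ge> 8 * B"
    show "b N j \<ge> 1 / 2 * (1 / (1 + 3 * z N j / 2)\<^sup>2)"
      unfolding b_def z_def by (rule shrinkage_ge[OF A N8])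
    show "v N j \<ge> 1 / 2 * (z N j / 2 / (1 + 3 * z N j / 2)\<^sup>2)"
      unfolding v_def z_def by (rule noise_gain_ge[OF A N8])
  qed (use assms B c\<theta> c\<sigma> in \<open>auto simp: z_def\<close>)
  have rt: "risk_term \<phi> \<nu> \<gamma> l \<sigma> N = (\<lambda>j. \<theta> j * ((l j)\<^sup>2 * b N j + (\<sigma> j)\<^sup>2 * v N j))" for N
    by (simp add: fun_eq_iff risk_term_def \<theta>_def b_def v_def)
  have risk: "expected_excess_risk \<phi> \<nu> \<gamma> l \<sigma> N = ennreal (R.risk N)" if N: "N \<ge> 1" for N
    unfolding R.risk_def rt[symmetric]
  proof (rule expected_excess_risk_eq_series[OF nu bor int on N assms(3) \<theta>_nonneg])
    show "(\<lambda>j. (\<phi> j \<bullet> cov_op \<nu> (\<phi> j)) * (l j)\<^sup>2) summable_on {1..}"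
      using R.summable_\<theta>l by (simp add: \<theta>_def)
    show "risk_term \<phi> \<nu> \<gamma> l \<sigma> N summable_on {1..}"
      unfolding rt by (rule R.risk_eq(1)[OF N])
    show "risk_term \<phi> \<nu> \<gamma> l \<sigma> N j \<ge> 0" if "j \<ge> 1" for j
      unfolding rt using R.\<theta>_nonneg[OF that] R.b01(1)[OF N that] R.v01(1)[OF N that]
      by (intro mult_nonneg_nonneg add_nonneg_nonneg) auto
  qed
  have rate_nonneg: "R.rate N \<ge> 0" for N
    by (simp add: R.rate_def)
  obtain K G where KG: "K \<ge> 0" "\<And>N. G N \<ge> 0" "G \<in> o(\<lambda>N. real N powr (- ((\<alpha> + s) / (\<alpha> + p))))"
    "\<And>N. N \<ge> 1 \<Longrightarrow> R.risk N \<le> K * R.rate N + G N"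
    by (rule R.risk_le) blast
  \<comment> \<open>the part of the risk below \<open>K * R.rate N\<close> and the excess over it, which is at most \<open>G N\<close>;
    the maximum with \<open>0\<close> only matters for \<open>N = 0\<close>\<close>
  define f where "f N = min (max 0 (R.risk N)) (K * R.rate N)" for N
  define g where "g N = max 0 (R.risk N) - f N" for N
  have f0: "f N \<ge> 0" and g0: "g N \<ge> 0" for N
    using KG(1) rate_nonneg[of N] by (auto simp: f_def g_def)
  have "f \<in> O(R.rate)"
    by (rule landau_o.bigI[of "max K 1"]) (use f0 rate_nonneg KG(1) in \<open>auto intro!: always_eventually simp: f_def min.coboundedI2 mult_right_mono\<close>)
  then have fO: "f \<in> O(\<lambda>N. real N powr (- ((\<alpha> + p - 1 / 2) / (\<alpha> + p))))"
    unfolding R.rate_def .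
  have "\<forall>\<^sub>F N in sequentially. norm (g N) \<le> norm (G N)"
    using eventually_ge_at_top[of 1]
  proof eventually_elim
    case (elim N)
    then show ?case
      using KG(2)[of N] KG(4)[OF elim] g0[of N] R.risk_nonneg[OF elim] by (auto simp: g_def f_def)
  qed
  then have go: "g \<in> o(\<lambda>N. real N powr (- ((\<alpha> + s) / (\<alpha> + p))))"
    using KG(3) by (rule landau_o.big_small_trans[OF landau_o.big_mono])
  have eq: "\<forall>\<^sub>F N in sequentially. expected_excess_risk \<phi> \<nu> \<gamma> l \<sigma> N = ennreal (f N + g N)"
    using eventually_ge_at_top[of 1]
    by eventually_elim (use risk R.risk_nonneg in \<open>simp add: g_def\<close>)
  have J: "J N = R.level N" for N
    using assms(12) by (simp add: R.level_def)
  obtain c where c: "c > 0"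
    "\<And>N. N \<ge> 1 \<Longrightarrow> real N \<ge> 8 * B \<Longrightarrow>
       c * (R.rate N + (\<Sum>\<^sub>\<infinity>j\<in>{J N<..}. real j powr (- 2 * \<alpha>) * (l j)\<^sup>2)) \<le> R.risk N"
    unfolding J by (rule R.risk_ge) blast
  have lower: "(\<lambda>N. enn2real (expected_excess_risk \<phi> \<nu> \<gamma> l \<sigma> N)) \<in>
      \<Omega>(\<lambda>N. \<tau> N * real N powr (- ((\<alpha> + p - 1 / 2) / (\<alpha> + p)))
             + (\<Sum>\<^sub>\<infinity>j\<in>{J N<..}. real j powr (- 2 * \<alpha>) * (l j)\<^sup>2))"
    if \<tau>: "\<forall>n\<ge>1. \<tau> n > 0" "\<tau> \<longlonglongrightarrow> 0" for \<tau> :: "nat \<Rightarrow> real"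
    unfolding R.rate_def[symmetric]
  proof (rule landau_omega.bigI[OF c(1)])
    let ?T = "\<lambda>N. \<Sum>\<^sub>\<infinity>j\<in>{J N<..}. real j powr (- 2 * \<alpha>) * (l j)\<^sup>2"
    have "\<forall>\<^sub>F N in sequentially. \<tau> N < 1"
      using \<tau>(2) by (rule order_tendstoD) simp
    moreover have "\<forall>\<^sub>F N in sequentially. real N \<ge> 8 * B"
      using filterlim_real_sequentially by (simp add: filterlim_at_top)
    ultimately show "\<forall>\<^sub>F N in sequentially.
      c * norm (\<tau> N * R.rate N + ?T N) \<le> norm (enn2real (expected_excess_risk \<phi> \<nu> \<gamma> l \<sigma> N))"
      using eventually_ge_at_top[of 1]
    proof eventually_elim
      case (elim N)
      have T: "?T N \<ge> 0" by (intro infsum_nonneg) auto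
      have t: "0 < \<tau> N" using \<tau>(1) elim(3) by simp
      have "\<tau> N * R.rate N + ?T N \<le> R.rate N + ?T N"
        using elim(1) t rate_nonneg[of N] by (simp add: mult_left_le_one_le)
      moreover have "\<tau> N * R.rate N + ?T N \<ge> 0"
        using t T rate_nonneg[of N] by simp
      ultimately have "c * norm (\<tau> N * R.rate N + ?T N) \<le> c * (R.rate N + ?T N)"
        using c(1) by simp
      also have "\<dots> \<le> R.risk N" by (rule c(2)[OF elim(3,2)])
      finally show ?case
        using risk[OF elim(3)] R.risk_nonneg[OF elim(3)] by simp
    qed
  qed
  show ?thesis
    using f0 g0 fO go eq lower by blast
qed

end
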